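(* For every $k\in\mathbb{N}$, the $4$-braid $\beta_k=\Delta^2\sigma_3^{-k}\in B_4$ satisfies $\psi'(\beta_k)\neq0$.
   Context: $B_4$ has generators $\sigma_1,\sigma_2,\sigma_3$, and $\Delta^2=(\sigma_1\sigma_2\sigma_3)^4$. $\psi'(\beta)$ is the reduced version of Plamenevskaya's transverse invariant: in the reduced Khovanov complex over $\mathbb{Z}/2\mathbb{Z}$ of the closed braid diagram $\hat\beta$ with a marked point (the quotient of the Khovanov complex by the subcomplex of generators labelling the marked circle $v_-$, quantum grading shifted by $-1$), it is the homology class of the generator in the oriented resolution (the $0$-resolution at positive crossings, the $1$-resolution at negative crossings) labelling the marked circle $v_+$ and all other circles $v_-$. *)

theory Defs
  imports Main
begin

text \<open>
Braid words on n strands: a list of crossings (i, positive), meaning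
sigma_i (if positive) or sigma_i^{-1} (otherwise), 1 <= i <= n-1, read top to bottom.
The closed braid diagram is cut into arcs: arc (l, q) is the vertical segment at
strand position q (0-based, q < n) lying just above crossing l (levels taken mod the
number of levels, so the closure identifies the bottom with the top).
\<close>

type_synonym bword = "(nat \<times> bool) list"
type_synonym arc = "nat \<times> nat"

definition nlev :: "bword \<Rightarrow> nat" where
  "nlev w = max 1 (length w)"

definition arcs :: "nat \<Rightarrow> bword \<Rightarrow> arc set" where
  "arcs n w = {0..<nlev w} \<times> {0..<n}"

text \<open>Smoothing of crossing c in the resolution S (S = set of crossings with the
1-resolution) is vertical (the oriented smoothing) iff either the crossing is
positive and gets the 0-resolution, or negative and gets the 1-resolution.\<close>

definition vert :: "bword \<Rightarrow> nat set \<Rightarrow> nat \<Rightarrow> bool" where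
  "vert w S c = (if snd (w ! c) then c \<notin> S else c \<in> S)"

definition cedges :: "nat \<Rightarrow> bword \<Rightarrow> nat set \<Rightarrow> nat \<Rightarrow> (arc \<times> arc) set" where
  "cedges n w S c =
     (let p = fst (w ! c) - 1; c' = Suc c mod nlev w in
       {((c, q), (c', q)) | q. q < n \<and> q \<noteq> p \<and> q \<noteq> Suc p} \<union>
       (if vert w S c then {((c, p), (c', p)), ((c, Suc p), (c', Suc p))}
        else {((c, p), (c, Suc p)), ((c', p), (c', Suc p))}))"

definition edges :: "nat \<Rightarrow> bword \<Rightarrow> nat set \<Rightarrow> (arc \<times> arc) set" where
  "edges n w S = (\<Union>c\<in>{0..<length w}. cedges n w S c)"

definition conn :: "nat \<Rightarrow> bword \<Rightarrow> nat set \<Rightarrow> (arc \<times> arc) set" where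
  "conn n w S = {(a, b). a \<in> arcs n w \<and> b \<in> arcs n w \<and>
                   (a, b) \<in> (edges n w S \<union> (edges n w S)\<inverse>)\<^sup>*}"

definition circles :: "nat \<Rightarrow> bword \<Rightarrow> nat set \<Rightarrow> arc set set" where
  "circles n w S = arcs n w // conn n w S"

definition touched :: "bword \<Rightarrow> nat \<Rightarrow> arc set" where
  "touched w c = (let p = fst (w ! c) - 1; c' = Suc c mod nlev w in
                   {(c, p), (c, Suc p), (c', p), (c', Suc p)})"

text \<open>Enhanced states (Khovanov generators): a resolution S together with the set P
of arcs lying on circles labelled v+ (all other circles are labelled v-).\<close>
definition gens :: "nat \<Rightarrow> bword \<Rightarrow> (nat set \<times> arc set) set" where
  "gens n w = {(S, P). S \<subseteq> {0..<length w} \<and> P \<subseteq> arcs n w \<and>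
                 (\<forall>a b. (a, b) \<in> conn n w S \<longrightarrow> (a \<in> P \<longleftrightarrow> b \<in> P))}"

text \<open>Matrix coefficient (in Z/2) of the Khovanov differential from generator x to
generator y: y arises by changing one 0-resolution to a 1-resolution, with the
merge map m(v+ v+) = v+, m(v+ v-) = m(v- v+) = v-, m(v- v-) = 0 and the split map
Delta(v+) = v+ v- + v- v+, Delta(v-) = v- v-, all other labels unchanged.\<close>
definition dcoef :: "nat \<Rightarrow> bword \<Rightarrow> (nat set \<times> arc set) \<Rightarrow> (nat set \<times> arc set) \<Rightarrow> bool" where
  "dcoef n w x y =
    (x \<in> gens n w \<and> y \<in> gens n w \<and>
     (case x of (S, P) \<Rightarrow> case y of (S', P') \<Rightarrow>
      \<exists>c<length w. c \<notin> S \<and> S' = insert c S \<and>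
        (let old = {C \<in> circles n w S. C \<inter> touched w c \<noteq> {}};
             new = {C \<in> circles n w S'. C \<inter> touched w c \<noteq> {}} in
          (\<forall>a \<in> arcs n w. a \<notin> \<Union>old \<longrightarrow> (a \<in> P \<longleftrightarrow> a \<in> P')) \<and>
          ((card old = 2 \<and> card new = 1 \<and>
              (\<exists>C\<in>old. C \<subseteq> P) \<and>
              (\<forall>C\<in>new. C \<subseteq> P' \<longleftrightarrow> (\<forall>D\<in>old. D \<subseteq> P))) \<or>
           (card old = 1 \<and> card new = 2 \<and>
              card {C\<in>new. C \<subseteq> P'} = (if \<Union>old \<subseteq> P then 1 else 0))))))"

text \<open>Reduced complex with marked point on arc m: the quotient by the subcomplex
spanned by generators labelling the marked circle v-, i.e. it has basis the
generators labelling the marked circle v+ and the induced differential.\<close>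
definition rgens :: "nat \<Rightarrow> bword \<Rightarrow> arc \<Rightarrow> (nat set \<times> arc set) set" where
  "rgens n w m = {x \<in> gens n w. m \<in> snd x}"

text \<open>Z/2-chains are finite sets of basis generators; the coefficient of y in dX.\<close>
definition rdiff_coeff :: "nat \<Rightarrow> bword \<Rightarrow> arc \<Rightarrow> (nat set \<times> arc set) set
     \<Rightarrow> (nat set \<times> arc set) \<Rightarrow> bool" where
  "rdiff_coeff n w m X y = odd (card {x \<in> X. x \<in> rgens n w m \<and> dcoef n w x y})"

text \<open>Generator of psi': oriented resolution (0 at positive, 1 at negative crossings),
marked circle v+, other circles v-.\<close>
definition psi_gen :: "nat \<Rightarrow> bword \<Rightarrow> arc \<Rightarrow> nat set \<times> arc set" where
  "psi_gen n w m = (let S0 = {c \<in> {0..<length w}. \<not> snd (w ! c)} in (S0, conn n w S0 `` {m}))"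

definition psi'_nonzero :: "nat \<Rightarrow> bword \<Rightarrow> arc \<Rightarrow> bool" where
  "psi'_nonzero n w m =
    (let x0 = psi_gen n w m in
      (\<forall>y \<in> rgens n w m. rdiff_coeff n w m {x0} y = False) \<and>
      \<not> (\<exists>X \<subseteq> rgens n w m. \<forall>y \<in> rgens n w m. rdiff_coeff n w m X y \<longleftrightarrow> y = x0))"

definition delta2_word :: bword where
  "delta2_word = concat (replicate 4 [(1, True), (2, True), (3, True)])"

definition beta_word :: "nat \<Rightarrow> bword" where
  "beta_word k = delta2_word @ replicate k (3, False)"

end

theory Submission
  imports Defs
begin

text \<open>
  Over the integers mod 2, relabelling the marked circle from \<open>v\<^sub>+\<close> to \<open>v\<^sub>-\<close> identifies the reduced complex
  with a subcomplex of the unreduced one. It is therefore enough to find a linear functional on the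
  unreduced complex that vanishes on boundaries and takes the value 1 on the generator of the
  oriented resolution all of whose circles are labelled \<open>v\<^sub>-\<close>.

  The functional comes from two simplifications. The states in which no positive crossing other than
  1, 2, 5, 7, 10 is 1-resolved span a quotient complex, namely that of
  \<open>\<sigma>\<^sub>2 \<sigma>\<^sub>3 \<sigma>\<^sub>3 \<sigma>\<^sub>2 \<sigma>\<^sub>2 \<sigma>\<^sub>3\<^sup>-\<^sup>k\<close>. The complex of \<open>\<sigma>\<^sub>3\<^sup>-\<^sup>k\<close> in turn
  retracts onto \<open>e \<rightarrow> e \<rightarrow> \<dots> \<rightarrow> e \<rightarrow> 1\<close>, where \<open>e\<close> is the cup-cap tangle: the
  retraction kills the states having a \<open>v\<^sub>+\<close> on a small circle between consecutive 0-resolved negative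
  crossings, and forgets these circles otherwise. The map \<open>e \<rightarrow> e\<close> is the sum of
  multiplication by \<open>v\<^sub>-\<close> on the top and on the bottom arc of \<open>e\<close>. What is left is a finite linear
  system over the integers mod 2 that does not depend on \<open>k\<close>.
\<close>

section \<open>Circles and the differential\<close>

text \<open>The functional cannot be the coefficient of that generator alone: if one negative
  crossing is 0-resolved, all other crossings are vertical and every circle is labelled v_-, then
  the differential of this state contains the generator. That value must be cancelled by states with
  a 1-resolved positive crossing, whose own values must be cancelled in turn. In homological degree
  0 the number of 1-resolved positive crossings equals the number of 0-resolved negative ones, so
  the \<open>j\<close>-th stage pairs \<open>j\<close> of the one kind with \<open>j\<close> of the
  other. As only five positive crossings take part, there is no stage beyond the fifth, however
  large \<open>k\<close> is. The five crossings keep the positivity that matters: on the last three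
  strands \<open>\<sigma>\<^sub>2 \<sigma>\<^sub>3 \<sigma>\<^sub>3 \<sigma>\<^sub>2\<close> is the
  full twist times \<open>\<sigma>\<^sub>3\<close> to the power \<open>-2\<close>, so the word that
  is left is conjugate to this full twist times \<open>\<sigma>\<^sub>2\<close> and
  \<open>\<sigma>\<^sub>3\<close> to the power \<open>-k - 2\<close>. The first strand becomes a
  circle of its own. Passing to the unreduced complex also removes the marked point: one functional
  serves all \<open>m\<close>.\<close>

definition wf_word :: "nat \<Rightarrow> bword \<Rightarrow> bool" where
  "wf_word n w \<longleftrightarrow> w \<noteq> [] \<and> (\<forall>c<length w. 1 \<le> fst (w ! c) \<and> fst (w ! c) < n)"

lemma nlev_eq_length: "wf_word n w \<Longrightarrow> nlev w = length w"
  by (cases w) (auto simp: wf_word_def nlev_def)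

lemma touched_subset_arcs:
  assumes "wf_word n w" "c < length w"
  shows "touched w c \<subseteq> arcs n w"
proof -
  have "Suc c mod length w < length w" using assms by (cases w) (auto intro: mod_less_divisor)
  moreover have "1 \<le> fst (w ! c)" "fst (w ! c) < n" using assms by (auto simp: wf_word_def)
  ultimately show ?thesis
    using assms by (auto simp: touched_def arcs_def Let_def nlev_eq_length[OF assms(1)])
qed

lemma edges_subset_arcs:
  assumes "wf_word n w"
  shows "edges n w S \<subseteq> arcs n w \<times> arcs n w"
proof -
  have "cedges n w S c \<subseteq> arcs n w \<times> arcs n w" if c: "c < length w" for c
  proof -
    have "Suc c mod length w < length w" using c by (cases w) (auto intro: mod_less_divisor)
    moreover have "1 \<le> fst (w ! c)" "fst (w ! c) < n" using assms c by (auto simp: wf_word_def)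
    ultimately show ?thesis
      using c by (auto simp: cedges_def arcs_def Let_def nlev_eq_length[OF assms] split: if_splits)
  qed
  then show ?thesis unfolding edges_def by (intro UN_least) simp
qed

lemma equiv_conn: "equiv (arcs n w) (conn n w S)"
proof (rule equivI)
  let ?E = "edges n w S \<union> (edges n w S)\<inverse>"
  have "sym ?E" by (auto simp: sym_def)
  then have "sym (?E\<^sup>*)" by (rule sym_rtrancl)
  then show "sym (conn n w S)" by (auto simp: sym_def conn_def)
  show "trans (conn n w S)" by (auto simp: trans_def conn_def)
  show "refl_on (arcs n w) (conn n w S)" by (auto simp: refl_on_def conn_def)
  show "conn n w S \<subseteq> arcs n w \<times> arcs n w" by (auto simp: conn_def)
qed

lemma conn_refl: "a \<in> arcs n w \<Longrightarrow> (a, a) \<in> conn n w S"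
  using equiv_conn[of n w S] by (auto simp: equiv_def refl_on_def)

lemma conn_sym: "(a, b) \<in> conn n w S \<Longrightarrow> (b, a) \<in> conn n w S"
  using equiv_conn[of n w S] by (metis equivE symD)

lemma conn_trans: "(a, b) \<in> conn n w S \<Longrightarrow> (b, c) \<in> conn n w S \<Longrightarrow> (a, c) \<in> conn n w S"
  using equiv_conn[of n w S] by (metis equivE transD)

lemma conn_arcs: "(a, b) \<in> conn n w S \<Longrightarrow> a \<in> arcs n w \<and> b \<in> arcs n w"
  by (simp add: conn_def)

lemma conn_cedge:
  assumes "wf_word n w" "c < length w" "(a, b) \<in> cedges n w S c"
  shows "(a, b) \<in> conn n w S"
proof -
  have "(a, b) \<in> edges n w S" using assms by (auto simp: edges_def)
  then show ?thesis using edges_subset_arcs[OF assms(1), of S] by (auto simp: conn_def)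
qed

text \<open>Circles are described by an explicit invariant \<open>\<rho>\<close> of arcs.
  \<open>sound\<close> is asked for single edges only, because invariance spreads along paths;
  \<open>complete\<close> asks for an actual path between arcs with equal invariant.\<close>

lemma conn_eqI:
  assumes sound: "\<And>c a b. c < length w \<Longrightarrow> (a, b) \<in> cedges n w S c \<Longrightarrow> \<rho> a = \<rho> b"
    and complete: "\<And>a b. a \<in> arcs n w \<Longrightarrow> b \<in> arcs n w \<Longrightarrow> \<rho> a = \<rho> b \<Longrightarrow> (a, b) \<in> conn n w S"
  shows "(a, b) \<in> conn n w S \<longleftrightarrow> a \<in> arcs n w \<and> b \<in> arcs n w \<and> \<rho> a = \<rho> b"
proof -
  have "\<rho> a = \<rho> b" if "(a, b) \<in> (edges n w S \<union> (edges n w S)\<inverse>)\<^sup>*"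
    using that
  proof (induction rule: rtrancl_induct)
    case (step y z)
    from step(2) have "\<rho> y = \<rho> z"
    proof
      assume "(y, z) \<in> edges n w S"
      then obtain c where "c < length w" "(y, z) \<in> cedges n w S c" by (auto simp: edges_def)
      then show ?thesis by (rule sound)
    next
      assume "(y, z) \<in> (edges n w S)\<inverse>"
      then obtain c where "c < length w" "(z, y) \<in> cedges n w S c" by (auto simp: edges_def)
      then show ?thesis by (rule sound[symmetric])
    qed
    with step(3) show ?case by simp
  qed simp
  then show ?thesis using complete[of a b] unfolding conn_def by blast
qed

abbreviation cls :: "nat \<Rightarrow> bword \<Rightarrow> nat set \<Rightarrow> arc \<Rightarrow> arc set" where
  "cls n w S a \<equiv> conn n w S `` {a}"

lemma cls_eq_iff:
  "a \<in> arcs n w \<Longrightarrow> b \<in> arcs n w \<Longrightarrow> cls n w S a = cls n w S b \<longleftrightarrow> (a, b) \<in> conn n w S"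
  using eq_equiv_class_iff[OF equiv_conn] by blast

lemma mem_cls_self: "a \<in> arcs n w \<Longrightarrow> a \<in> cls n w S a"
  by (auto intro: conn_refl)

lemma circles_touching:
  assumes "T \<subseteq> arcs n w"
  shows "{C \<in> circles n w S. C \<inter> T \<noteq> {}} = cls n w S ` T"
proof (intro set_eqI iffI)
  fix C assume "C \<in> {C \<in> circles n w S. C \<inter> T \<noteq> {}}"
  then obtain a t where a: "a \<in> arcs n w" "C = cls n w S a" "t \<in> C" "t \<in> T"
    by (auto simp: circles_def quotient_def)
  then have "(a, t) \<in> conn n w S" by auto
  then have "C = cls n w S t" using a by (metis cls_eq_iff conn_arcs)
  then show "C \<in> cls n w S ` T" using a by auto
next
  fix C assume "C \<in> cls n w S ` T"
  then show "C \<in> {C \<in> circles n w S. C \<inter> T \<noteq> {}}"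
    using assms mem_cls_self by (fastforce simp: circles_def quotient_def)
qed

section \<open>Effect of changing one crossing on the circles\<close>

lemma cedges_insert_other: "c \<noteq> d \<Longrightarrow> cedges n w (insert c S) d = cedges n w S d"
  by (auto simp: cedges_def vert_def Let_def)

lemma cedges_insert_touched:
  "(a, b) \<in> cedges n w S c \<Longrightarrow>
   (a, b) \<in> cedges n w (insert c S) c \<or> a \<in> touched w c \<and> b \<in> touched w c"
  "(a, b) \<in> cedges n w (insert c S) c \<Longrightarrow>
   (a, b) \<in> cedges n w S c \<or> a \<in> touched w c \<and> b \<in> touched w c"
  by (auto simp: cedges_def touched_def Let_def split: if_splits)

lemma edges_insert_touched:
  "(a, b) \<in> edges n w S \<Longrightarrow>
   (a, b) \<in> edges n w (insert c S) \<or> a \<in> touched w c \<and> b \<in> touched w c"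
  "(a, b) \<in> edges n w (insert c S) \<Longrightarrow>
   (a, b) \<in> edges n w S \<or> a \<in> touched w c \<and> b \<in> touched w c"
  unfolding edges_def by (metis UN_iff cedges_insert_other cedges_insert_touched)+

text \<open>Edges of \<open>S'\<close> missing from \<open>S\<close> have both ends in
  \<open>T\<close>. A path of \<open>S'\<close> that starts on a circle of \<open>S\<close> avoiding
  \<open>T\<close> can never use one of them, so it stays on that circle. Since \<open>S\<close> and
  \<open>S'\<close> are arbitrary, the lemma yields both inclusions below.\<close>

lemma cls_mono_untouched:
  assumes E: "\<And>a b. (a, b) \<in> edges n w S' \<Longrightarrow> (a, b) \<in> edges n w S \<or> a \<in> T \<and> b \<in> T"
    and a: "cls n w S a \<inter> T = {}"
    and wf: "wf_word n w"
  shows "cls n w S' a \<subseteq> cls n w S a"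
proof
  fix b assume "b \<in> cls n w S' a"
  then have "a \<in> arcs n w" and "(a, b) \<in> (edges n w S' \<union> (edges n w S')\<inverse>)\<^sup>*" by (auto simp: conn_def)
  from this(2) show "b \<in> cls n w S a"
  proof (induction rule: rtrancl_induct)
    case base
    then show ?case using \<open>a \<in> arcs n w\<close> by (rule mem_cls_self)
  next
    case (step y z)
    then have "y \<notin> T" using a by auto
    then have yz: "(y, z) \<in> edges n w S \<union> (edges n w S)\<inverse>" using step(2) E by blast
    then have "(y, z) \<in> conn n w S" using edges_subset_arcs[OF wf, of S] by (auto simp: conn_def)
    then show ?case using step(3) conn_trans by (metis Image_singleton_iff)
  qed
qed

lemma cls_insert_untouched:
  assumes "wf_word n w" "cls n w S a \<inter> touched w c = {}"
  shows "cls n w (insert c S) a = cls n w S a"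
proof
  show *: "cls n w (insert c S) a \<subseteq> cls n w S a"
    using cls_mono_untouched[OF _ assms(2,1)] edges_insert_touched(2) by metis
  then have "cls n w (insert c S) a \<inter> touched w c = {}" using assms(2) by auto
  then show "cls n w S a \<subseteq> cls n w (insert c S) a"
    using cls_mono_untouched[OF _ _ assms(1)] edges_insert_touched(1) by metis
qed

lemma cls_insert_untouched':
  assumes "wf_word n w" "cls n w (insert c S) a \<inter> touched w c = {}"
  shows "cls n w (insert c S) a = cls n w S a"
proof
  show *: "cls n w S a \<subseteq> cls n w (insert c S) a"
    using cls_mono_untouched[OF _ assms(2,1)] edges_insert_touched(1) by metis
  then have "cls n w S a \<inter> touched w c = {}" using assms(2) by auto
  then show "cls n w (insert c S) a \<subseteq> cls n w S a"
    using cls_mono_untouched[OF _ _ assms(1)] edges_insert_touched(2) by metis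
qed

lemma in_Union_cls_iff:
  assumes "T \<subseteq> arcs n w" "a \<in> arcs n w"
  shows "a \<in> \<Union> (cls n w S ` T) \<longleftrightarrow> cls n w S a \<inter> T \<noteq> {}"
proof
  assume "a \<in> \<Union> (cls n w S ` T)"
  then obtain t where "t \<in> T" "(t, a) \<in> conn n w S" by blast
  then show "cls n w S a \<inter> T \<noteq> {}" using conn_sym by blast
next
  assume "cls n w S a \<inter> T \<noteq> {}"
  then obtain t where "t \<in> T" "(a, t) \<in> conn n w S" by blast
  then show "a \<in> \<Union> (cls n w S ` T)" using conn_sym by blast
qed

lemma Union_cls_subset_arcs: "\<Union> (cls n w S ` T) \<subseteq> arcs n w"
  by (auto simp: conn_def)

text \<open>Circles away from the crossing are the same before and after, so the other circles must
  cover the same arcs before and after: a merge or split only redistributes them.\<close>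

lemma Union_cls_insert:
  assumes "wf_word n w" "c < length w"
  shows "\<Union> (cls n w (insert c S) ` touched w c) = \<Union> (cls n w S ` touched w c)"
proof -
  have T: "touched w c \<subseteq> arcs n w" using assms by (rule touched_subset_arcs)
  have "cls n w (insert c S) a \<inter> touched w c = {} \<longleftrightarrow> cls n w S a \<inter> touched w c = {}" for a
    using cls_insert_untouched[OF assms(1)] cls_insert_untouched'[OF assms(1)] by metis
  then have "a \<in> \<Union> (cls n w (insert c S) ` touched w c) \<longleftrightarrow> a \<in> \<Union> (cls n w S ` touched w c)"
    if "a \<in> arcs n w" for a
    using that in_Union_cls_iff[OF T] by presburger
  then show ?thesis
    using Union_cls_subset_arcs[of n w S "touched w c"]
      Union_cls_subset_arcs[of n w "insert c S" "touched w c"] by blast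
qed

section \<open>The differential at a merge and at a split\<close>

lemma gensI:
  assumes "S \<subseteq> {0..<length w}" "P \<subseteq> arcs n w"
    and "\<And>a b. a \<in> P \<Longrightarrow> (a, b) \<in> conn n w S \<Longrightarrow> b \<in> P"
  shows "(S, P) \<in> gens n w"
  using assms conn_sym unfolding gens_def by blast

lemma gens_conn: "(S, P) \<in> gens n w \<Longrightarrow> (a, b) \<in> conn n w S \<Longrightarrow> a \<in> P \<longleftrightarrow> b \<in> P"
  unfolding gens_def by blast

lemma gens_cls_subset_iff:
  "(S, P) \<in> gens n w \<Longrightarrow> a \<in> arcs n w \<Longrightarrow> cls n w S a \<subseteq> P \<longleftrightarrow> a \<in> P"
  using mem_cls_self gens_conn by blast

lemma finite_gens: "finite (gens n w)"
proof -
  have "gens n w \<subseteq> Pow {0..<length w} \<times> Pow (arcs n w)" by (auto simp: gens_def)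
  then show ?thesis by (rule finite_subset) (auto simp: arcs_def)
qed

text \<open>The crossing is determined by the two resolutions, so the existential quantifier of
  \<open>dcoef\<close> disappears.\<close>

lemma dcoef_insert_iff:
  assumes wf: "wf_word n w" and c: "c < length w" "c \<notin> S"
  shows "dcoef n w (S, P) (insert c S, P') \<longleftrightarrow>
    (S, P) \<in> gens n w \<and> (insert c S, P') \<in> gens n w \<and>
    (let old = cls n w S ` touched w c; new = cls n w (insert c S) ` touched w c in
      (\<forall>a \<in> arcs n w. a \<notin> \<Union>old \<longrightarrow> (a \<in> P \<longleftrightarrow> a \<in> P')) \<and>
      ((card old = 2 \<and> card new = 1 \<and>
          (\<exists>C\<in>old. C \<subseteq> P) \<and>
          (\<forall>C\<in>new. C \<subseteq> P' \<longleftrightarrow> (\<forall>D\<in>old. D \<subseteq> P))) \<or>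
       (card old = 1 \<and> card new = 2 \<and>
          card {C\<in>new. C \<subseteq> P'} = (if \<Union>old \<subseteq> P then 1 else 0))))"
proof -
  have *: "(\<exists>d<length w. d \<notin> S \<and> insert c S = insert d S \<and> Q d) \<longleftrightarrow> Q c" for Q
  proof
    assume "\<exists>d<length w. d \<notin> S \<and> insert c S = insert d S \<and> Q d"
    then obtain d where "d \<notin> S" "insert c S = insert d S" "Q d" by blast
    moreover then have "d = c" using c by blast
    ultimately show "Q c" by simp
  qed (use c in blast)
  show ?thesis
    unfolding dcoef_def prod.case * circles_touching[OF touched_subset_arcs[OF wf c(1)]] ..
qed

lemma dcoef_cases:
  assumes "dcoef n w (S, P) y"
  obtains c P' where "c < length w" "c \<notin> S" "y = (insert c S, P')"
  using assms unfolding dcoef_def by (cases y) auto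

lemma gens_insertI:
  assumes wf: "wf_word n w" and c: "c < length w" and g: "(S, P) \<in> gens n w"
    and P': "P' \<subseteq> arcs n w"
    and out: "\<And>a. a \<in> arcs n w \<Longrightarrow> a \<notin> \<Union> (cls n w S ` touched w c) \<Longrightarrow> a \<in> P' \<longleftrightarrow> a \<in> P"
    and inn: "\<And>t. t \<in> touched w c \<Longrightarrow>
      cls n w (insert c S) t \<subseteq> P' \<or> cls n w (insert c S) t \<inter> P' = {}"
  shows "(insert c S, P') \<in> gens n w"
proof (rule gensI)
  show "insert c S \<subseteq> {0..<length w}" using g c by (auto simp: gens_def)
  show "P' \<subseteq> arcs n w" by fact
  fix a b assume a: "a \<in> P'" and ab: "(a, b) \<in> conn n w (insert c S)"
  have T: "touched w c \<subseteq> arcs n w" using wf c by (rule touched_subset_arcs)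
  have arcs: "a \<in> arcs n w" "b \<in> arcs n w" using conn_arcs[OF ab] by auto
  let ?U = "\<Union> (cls n w S ` touched w c)"
  note U = Union_cls_insert[OF wf c, of S]
  show "b \<in> P'"
  proof (cases "a \<in> ?U")
    case True
    then obtain t where t: "t \<in> touched w c" "(t, a) \<in> conn n w (insert c S)"
      unfolding U[symmetric] by blast
    then have "(t, b) \<in> conn n w (insert c S)" using ab conn_trans by metis
    then show ?thesis using inn[OF t(1)] t(2) a by blast
  next
    case False
    then have "cls n w S a \<inter> touched w c = {}" using in_Union_cls_iff[OF T arcs(1)] by blast
    then have "cls n w (insert c S) a = cls n w S a" by (rule cls_insert_untouched[OF wf])
    with ab have ab': "(a, b) \<in> conn n w S" by blast
    have b: "b \<notin> ?U"
    proof
      assume "b \<in> ?U"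
      then obtain t where "t \<in> touched w c" "(t, b) \<in> conn n w S" by blast
      then have "a \<in> ?U" using conn_trans[OF _ conn_sym[OF ab']] by blast
      with False show False by contradiction
    qed
    have "a \<in> P" using a False out arcs by blast
    then have "b \<in> P" using gens_conn[OF g ab'] by blast
    then show ?thesis using b out arcs by blast
  qed
qed

text \<open>Labels are stored as a set of arcs. Hence v_+ v_+ leaves the set as it is, a mixed pair
  deletes both circles from it, and v_- v_- has no target. There is at most one target.\<close>

lemma dcoef_merge_iff:
  assumes wf: "wf_word n w" and c: "c < length w" "c \<notin> S" and g: "(S, P) \<in> gens n w"
    and uv: "u \<in> touched w c" "v \<in> touched w c"
    and old: "cls n w S ` touched w c = {cls n w S u, cls n w S v}" "(u, v) \<notin> conn n w S"
    and new: "cls n w (insert c S) ` touched w c = {cls n w (insert c S) u}"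
  shows "dcoef n w (S, P) (insert c S, P') \<longleftrightarrow>
    u \<in> P \<and> v \<in> P \<and> P' = P \<or> (u \<in> P) \<noteq> (v \<in> P) \<and> P' = P - (cls n w S u \<union> cls n w S v)"
proof -
  let ?S' = "insert c S"
  let ?U = "cls n w S u \<union> cls n w S v"
  have T: "touched w c \<subseteq> arcs n w" using wf c(1) by (rule touched_subset_arcs)
  have arcs: "u \<in> arcs n w" "v \<in> arcs n w" using uv T by auto
  have U: "cls n w ?S' u = ?U" using Union_cls_insert[OF wf c(1), of S] by (simp add: old new)
  have ne: "cls n w S u \<noteq> cls n w S v" using old(2) cls_eq_iff[OF arcs] by blast
  have iff: "dcoef n w (S, P) (?S', P') \<longleftrightarrow> (?S', P') \<in> gens n w \<and>
      (\<forall>a \<in> arcs n w. a \<notin> ?U \<longrightarrow> (a \<in> P \<longleftrightarrow> a \<in> P')) \<and> (u \<in> P \<or> v \<in> P) \<and>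
      (?U \<subseteq> P' \<longleftrightarrow> u \<in> P \<and> v \<in> P)"
    unfolding dcoef_insert_iff[OF wf c] old(1) new Let_def U[symmetric]
    using g ne gens_cls_subset_iff[OF g arcs(1)] gens_cls_subset_iff[OF g arcs(2)]
    by (auto simp: U)
  have PU: "u \<in> P \<Longrightarrow> cls n w S u \<subseteq> P" "u \<notin> P \<Longrightarrow> cls n w S u \<inter> P = {}"
    "v \<in> P \<Longrightarrow> cls n w S v \<subseteq> P" "v \<notin> P \<Longrightarrow> cls n w S v \<inter> P = {}"
    using gens_conn[OF g] by blast+
  have Uarcs: "?U \<subseteq> arcs n w" by (auto simp: conn_def)
  have Parcs: "P \<subseteq> arcs n w" using g by (auto simp: gens_def)
  have uU: "u \<in> ?U" using mem_cls_self arcs by blast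
  show ?thesis
  proof
    assume d: "dcoef n w (S, P) (?S', P')"
    note d' = d[unfolded iff]
    have P'arcs: "P' \<subseteq> arcs n w" using d' by (auto simp: gens_def)
    have P'U: "?U \<subseteq> P' \<or> ?U \<inter> P' = {}" using d' gens_conn[of ?S' P' n w u] U by blast
    show "u \<in> P \<and> v \<in> P \<and> P' = P \<or> (u \<in> P) \<noteq> (v \<in> P) \<and> P' = P - ?U"
    proof (cases "u \<in> P \<and> v \<in> P")
      case True
      then have "P' = P" using d' PU P'arcs Parcs by blast
      with True show ?thesis by simp
    next
      case False
      then have "P' = P - ?U" using d' P'U P'arcs Parcs by blast
      with False d' show ?thesis by blast
    qed
  next
    assume h: "u \<in> P \<and> v \<in> P \<and> P' = P \<or> (u \<in> P) \<noteq> (v \<in> P) \<and> P' = P - ?U"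
    have "(?S', P') \<in> gens n w"
    proof (rule gens_insertI[OF wf c(1) g])
      show "P' \<subseteq> arcs n w" using h Parcs by blast
      show "a \<in> P' \<longleftrightarrow> a \<in> P" if "a \<notin> \<Union> (cls n w S ` touched w c)" for a
        using that h unfolding old(1) by auto
      fix t assume "t \<in> touched w c"
      then have "cls n w ?S' t \<in> cls n w ?S' ` touched w c" by (rule imageI)
      then have "cls n w ?S' t = ?U" unfolding new U by simp
      then show "cls n w ?S' t \<subseteq> P' \<or> cls n w ?S' t \<inter> P' = {}" using h PU by blast
    qed
    then show "dcoef n w (S, P) (?S', P')" unfolding iff using h PU uU by blast
  qed
qed

text \<open>Dually, v_- leaves the set as it is, while v_+ has two targets, each deleting one of the
  two new circles.\<close>

lemma dcoef_split_iff:
  assumes wf: "wf_word n w" and c: "c < length w" "c \<notin> S" and g: "(S, P) \<in> gens n w"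
    and uv: "u \<in> touched w c" "v \<in> touched w c"
    and old: "cls n w S ` touched w c = {cls n w S u}"
    and new: "cls n w (insert c S) ` touched w c = {cls n w (insert c S) u, cls n w (insert c S) v}"
      "(u, v) \<notin> conn n w (insert c S)"
  shows "dcoef n w (S, P) (insert c S, P') \<longleftrightarrow>
    u \<notin> P \<and> P' = P \<or>
    u \<in> P \<and> (P' = P - cls n w (insert c S) u \<or> P' = P - cls n w (insert c S) v)"
proof -
  let ?S' = "insert c S"
  let ?u = "cls n w ?S' u" and ?v = "cls n w ?S' v"
  have T: "touched w c \<subseteq> arcs n w" using wf c(1) by (rule touched_subset_arcs)
  have arcs: "u \<in> arcs n w" "v \<in> arcs n w" using uv T by auto
  have U: "cls n w S u = ?u \<union> ?v" using Union_cls_insert[OF wf c(1), of S] by (simp add: old new)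
  have ne: "?u \<noteq> ?v" using new(2) cls_eq_iff[OF arcs] by blast
  have disj: "?u \<inter> ?v = {}"
    using new(2) conn_sym conn_trans by (metis Image_singleton_iff disjoint_iff)
  have card: "card {C \<in> {?u, ?v}. C \<subseteq> P'} = of_bool (u \<in> P') + of_bool (v \<in> P')"
    if "(?S', P') \<in> gens n w"
  proof -
    have "{C \<in> {?u, ?v}. C \<subseteq> P'} = (if u \<in> P' then {?u} else {}) \<union> (if v \<in> P' then {?v} else {})"
      using gens_cls_subset_iff[OF that arcs(1)] gens_cls_subset_iff[OF that arcs(2)] by fastforce
    then show ?thesis using ne by auto
  qed
  have iff: "dcoef n w (S, P) (?S', P') \<longleftrightarrow> (?S', P') \<in> gens n w \<and>
      (\<forall>a \<in> arcs n w. a \<notin> ?u \<union> ?v \<longrightarrow> (a \<in> P \<longleftrightarrow> a \<in> P')) \<and>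
      (u \<in> P \<longleftrightarrow> (u \<in> P') \<noteq> (v \<in> P')) \<and> (u \<notin> P \<longrightarrow> u \<notin> P' \<and> v \<notin> P')"
  proof (cases "(?S', P') \<in> gens n w")
    case True
    have "cls n w S u \<subseteq> P \<longleftrightarrow> u \<in> P" by (rule gens_cls_subset_iff[OF g arcs(1)])
    moreover have "card {?u, ?v} = 2" using ne by simp
    ultimately show ?thesis
      unfolding dcoef_insert_iff[OF wf c] old(1) new(1) Let_def card[OF True] U[symmetric]
      by (simp add: g True split: if_splits)
  next
    case False
    then show ?thesis by (simp add: dcoef_insert_iff[OF wf c])
  qed
  have PU: "u \<in> P \<Longrightarrow> ?u \<union> ?v \<subseteq> P" "u \<notin> P \<Longrightarrow> (?u \<union> ?v) \<inter> P = {}"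
    using gens_conn[OF g, of u] U by blast+
  have Parcs: "P \<subseteq> arcs n w" using g by (auto simp: gens_def)
  have self: "u \<in> ?u" "v \<in> ?v" using mem_cls_self arcs by blast+
  show ?thesis
  proof
    assume d: "dcoef n w (S, P) (?S', P')"
    note d' = d[unfolded iff]
    have P'arcs: "P' \<subseteq> arcs n w" using d' by (auto simp: gens_def)
    then have out: "a \<in> P \<longleftrightarrow> a \<in> P'" if "a \<notin> ?u \<union> ?v" for a using that d' Parcs by blast
    have uv': "u \<in> P \<longleftrightarrow> (u \<in> P') \<noteq> (v \<in> P')" "u \<notin> P \<longrightarrow> u \<notin> P' \<and> v \<notin> P'"
      using d' by blast+
    have P'U: "u \<in> P' \<Longrightarrow> ?u \<subseteq> P'" "u \<notin> P' \<Longrightarrow> ?u \<inter> P' = {}"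
      "v \<in> P' \<Longrightarrow> ?v \<subseteq> P'" "v \<notin> P' \<Longrightarrow> ?v \<inter> P' = {}" 
      using d' gens_conn[of ?S' P' n w] by blast+
    show "u \<notin> P \<and> P' = P \<or> u \<in> P \<and> (P' = P - ?u \<or> P' = P - ?v)"
    proof (cases "u \<in> P")
      case True
      show ?thesis
      proof (cases "u \<in> P'")
        case u: True
        then have "a \<in> P' \<longleftrightarrow> a \<in> P - ?v" for a
          using True uv' PU(1) P'U(1,4) disj out[of a] by blast
        then have "P' = P - ?v" by (intro set_eqI)
        with True show ?thesis by simp
      next
        case u: False
        then have "a \<in> P' \<longleftrightarrow> a \<in> P - ?u" for a
          using True uv' PU(1) P'U(2,3) disj out[of a] by blast
        then have "P' = P - ?u" by (intro set_eqI)
        with True show ?thesis by simp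
      qed
    next
      case False
      then have "a \<in> P' \<longleftrightarrow> a \<in> P" for a
        using uv' PU(2) P'U(2,4) out[of a] by blast
      then have "P' = P" by (intro set_eqI)
      with False show ?thesis by simp
    qed
  next
    assume h: "u \<notin> P \<and> P' = P \<or> u \<in> P \<and> (P' = P - ?u \<or> P' = P - ?v)"
    have "(?S', P') \<in> gens n w"
    proof (rule gens_insertI[OF wf c(1) g])
      show "P' \<subseteq> arcs n w" using h Parcs by blast
      show "a \<in> P' \<longleftrightarrow> a \<in> P" if "a \<notin> \<Union> (cls n w S ` touched w c)" for a
        using that h unfolding old(1) U by auto
      fix t assume "t \<in> touched w c"
      then have "cls n w ?S' t \<in> cls n w ?S' ` touched w c" by (rule imageI)
      then have "cls n w ?S' t = ?u \<or> cls n w ?S' t = ?v" unfolding new by simp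
      then show "cls n w ?S' t \<subseteq> P' \<or> cls n w ?S' t \<inter> P' = {}" using h PU disj by blast
    qed
    then show "dcoef n w (S, P) (?S', P')" unfolding iff using h PU self disj by blast
  qed
qed

section \<open>Parity of a functional on the differential, one crossing at a time\<close>

abbreviation arcTL :: "bword \<Rightarrow> nat \<Rightarrow> arc" where "arcTL w c \<equiv> (c, fst (w ! c) - 1)"
abbreviation arcTR :: "bword \<Rightarrow> nat \<Rightarrow> arc" where "arcTR w c \<equiv> (c, Suc (fst (w ! c) - 1))"
abbreviation arcBL :: "bword \<Rightarrow> nat \<Rightarrow> arc" where "arcBL w c \<equiv> (Suc c mod nlev w, fst (w ! c) - 1)"
abbreviation arcBR :: "bword \<Rightarrow> nat \<Rightarrow> arc" where "arcBR w c \<equiv> (Suc c mod nlev w, Suc (fst (w ! c) - 1))"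

lemma touched_eq: "touched w c = {arcTL w c, arcTR w c, arcBL w c, arcBR w c}"
  by (auto simp: touched_def Let_def)

lemma cls_touched_vert:
  assumes "wf_word n w" "c < length w" "vert w S c"
  shows "cls n w S ` touched w c = {cls n w S (arcTL w c), cls n w S (arcTR w c)}"
proof -
  have "(arcTL w c, arcBL w c) \<in> conn n w S" "(arcTR w c, arcBR w c) \<in> conn n w S"
    by (rule conn_cedge[OF assms(1,2)], simp add: cedges_def Let_def assms(3))+
  then have "cls n w S (arcBL w c) = cls n w S (arcTL w c)" "cls n w S (arcBR w c) = cls n w S (arcTR w c)"
    using cls_eq_iff conn_arcs by metis+
  then show ?thesis by (auto simp: touched_eq)
qed

lemma cls_touched_horiz:
  assumes "wf_word n w" "c < length w" "\<not> vert w S c"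
  shows "cls n w S ` touched w c = {cls n w S (arcTL w c), cls n w S (arcBL w c)}"
proof -
  have "(arcTL w c, arcTR w c) \<in> conn n w S" "(arcBL w c, arcBR w c) \<in> conn n w S"
    by (rule conn_cedge[OF assms(1,2)], simp add: cedges_def Let_def assms(3))+
  then have "cls n w S (arcTR w c) = cls n w S (arcTL w c)" "cls n w S (arcBR w c) = cls n w S (arcBL w c)"
    using cls_eq_iff conn_arcs by metis+
  then show ?thesis by (auto simp: touched_eq)
qed

text \<open>The arc that lies opposite to the top left arc of crossing \<open>c\<close> before, respectively after,
  its resolution is changed from 0 to 1.\<close>

definition opp0 :: "bword \<Rightarrow> nat \<Rightarrow> arc" where
  "opp0 w c = (if snd (w ! c) then arcTR w c else arcBL w c)"

definition opp1 :: "bword \<Rightarrow> nat \<Rightarrow> arc" where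
  "opp1 w c = (if snd (w ! c) then arcBL w c else arcTR w c)"

lemma cls_touched_old:
  assumes "wf_word n w" "c < length w" "c \<notin> S"
  shows "cls n w S ` touched w c = {cls n w S (arcTL w c), cls n w S (opp0 w c)}"
  using cls_touched_vert[OF assms(1,2), of S] cls_touched_horiz[OF assms(1,2), of S] assms(3)
  by (auto simp: vert_def opp0_def)

lemma cls_touched_new:
  assumes "wf_word n w" "c < length w"
  shows "cls n w (insert c S) ` touched w c =
    {cls n w (insert c S) (arcTL w c), cls n w (insert c S) (opp1 w c)}"
  using cls_touched_vert[OF assms(1,2), of "insert c S"] cls_touched_horiz[OF assms(1,2), of "insert c S"]
  by (auto simp: vert_def opp1_def)

text \<open>The parity of the size of this set is the contribution of crossing \<open>c\<close> to
  the value of the functional \<open>\<phi>\<close> on the boundary of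
  \<open>(S, P)\<close>.\<close>

definition dset :: "nat \<Rightarrow> bword \<Rightarrow> (nat set \<times> arc set \<Rightarrow> bool) \<Rightarrow> nat set \<Rightarrow> arc set \<Rightarrow> nat
    \<Rightarrow> arc set set" where
  "dset n w \<phi> S P c = {P'. dcoef n w (S, P) (insert c S, P') \<and> \<phi> (insert c S, P')}"

lemma odd_card_dset_merge:
  assumes wf: "wf_word n w" and c: "c < length w" "c \<notin> S" and g: "(S, P) \<in> gens n w"
    and "(arcTL w c, opp0 w c) \<notin> conn n w S"
    and "(arcTL w c, opp1 w c) \<in> conn n w (insert c S)"
  shows "odd (card (dset n w \<phi> S P c)) \<longleftrightarrow>
    arcTL w c \<in> P \<and> opp0 w c \<in> P \<and> \<phi> (insert c S, P) \<or>
    (arcTL w c \<in> P) \<noteq> (opp0 w c \<in> P) \<and>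
      \<phi> (insert c S, P - (cls n w S (arcTL w c) \<union> cls n w S (opp0 w c)))"
proof -
  have "cls n w (insert c S) (opp1 w c) = cls n w (insert c S) (arcTL w c)"
    using assms(6) cls_eq_iff conn_arcs by metis
  then have new: "cls n w (insert c S) ` touched w c = {cls n w (insert c S) (arcTL w c)}"
    using cls_touched_new[OF wf c(1)] by auto
  have "dset n w \<phi> S P c =
    (if arcTL w c \<in> P \<and> opp0 w c \<in> P \<and> \<phi> (insert c S, P) then {P} else {}) \<union>
    (if (arcTL w c \<in> P) \<noteq> (opp0 w c \<in> P) \<and>
      \<phi> (insert c S, P - (cls n w S (arcTL w c) \<union> cls n w S (opp0 w c)))
     then {P - (cls n w S (arcTL w c) \<union> cls n w S (opp0 w c))} else {})"
    unfolding dset_def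
    by (subst dcoef_merge_iff[OF wf c g _ _ cls_touched_old[OF wf c] assms(5) new])
      (auto simp: touched_eq opp0_def)
  then show ?thesis by auto
qed

lemma odd_card_dset_split:
  assumes wf: "wf_word n w" and c: "c < length w" "c \<notin> S" and g: "(S, P) \<in> gens n w"
    and "(arcTL w c, opp0 w c) \<in> conn n w S"
    and "(arcTL w c, opp1 w c) \<notin> conn n w (insert c S)"
  shows "odd (card (dset n w \<phi> S P c)) \<longleftrightarrow>
    (if arcTL w c \<in> P
     then \<phi> (insert c S, P - cls n w (insert c S) (arcTL w c)) \<noteq>
          \<phi> (insert c S, P - cls n w (insert c S) (opp1 w c))
     else \<phi> (insert c S, P))"
proof -
  let ?u = "cls n w (insert c S) (arcTL w c)" and ?v = "cls n w (insert c S) (opp1 w c)"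
  have t: "arcTL w c \<in> touched w c" "opp1 w c \<in> touched w c" by (auto simp: touched_eq opp1_def)
  then have arcs: "arcTL w c \<in> arcs n w" "opp1 w c \<in> arcs n w"
    using touched_subset_arcs[OF wf c(1)] by auto
  have "cls n w S (opp0 w c) = cls n w S (arcTL w c)"
    using assms(5) cls_eq_iff conn_arcs by metis
  then have old: "cls n w S ` touched w c = {cls n w S (arcTL w c)}"
    using cls_touched_old[OF wf c] by auto
  \<comment> \<open>The top left arc lies on the first new circle but not on the second. So the two
    targets differ, and their values add mod 2, which is \<open>\<noteq>\<close> on
    Booleans.\<close>
  have ne: "P - ?u \<noteq> P - ?v" if "arcTL w c \<in> P"
    using that assms(6) mem_cls_self[OF arcs(1)] conn_sym by blast
  have "dset n w \<phi> S P c =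
    (if arcTL w c \<notin> P \<and> \<phi> (insert c S, P) then {P} else {}) \<union>
    (if arcTL w c \<in> P \<and> \<phi> (insert c S, P - ?u) then {P - ?u} else {}) \<union>
    (if arcTL w c \<in> P \<and> \<phi> (insert c S, P - ?v) then {P - ?v} else {})"
    unfolding dset_def
    by (subst dcoef_split_iff[OF wf c g t old cls_touched_new[OF wf c(1)] assms(6)]) auto
  then show ?thesis using ne by auto
qed

lemma card_dcoef_eq_sum_dset:
  assumes "(S, P) \<in> gens n w"
  shows "card {y. \<phi> y \<and> dcoef n w (S, P) y} = (\<Sum>c\<in>{0..<length w} - S. card (dset n w \<phi> S P c))"
proof -
  let ?C = "{0..<length w} - S"
  have "{y. \<phi> y \<and> dcoef n w (S, P) y} = (\<Union>c\<in>?C. Pair (insert c S) ` dset n w \<phi> S P c)"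
  proof (intro set_eqI iffI)
    fix y assume y: "y \<in> {y. \<phi> y \<and> dcoef n w (S, P) y}"
    then obtain c P' where "c < length w" "c \<notin> S" "y = (insert c S, P')"
      by (auto elim: dcoef_cases)
    with y show "y \<in> (\<Union>c\<in>?C. Pair (insert c S) ` dset n w \<phi> S P c)"
      by (auto simp: dset_def intro!: bexI[of _ c])
  qed (auto simp: dset_def)
  also have "card \<dots> = (\<Sum>c\<in>?C. card (Pair (insert c S) ` dset n w \<phi> S P c))"
  proof (rule card_UN_disjoint)
    show "\<forall>c\<in>?C. finite (Pair (insert c S) ` dset n w \<phi> S P c)"
    proof
      fix c
      have "Pair (insert c S) ` dset n w \<phi> S P c \<subseteq> gens n w"
        by (auto simp: dset_def dcoef_def)
      then show "finite (Pair (insert c S) ` dset n w \<phi> S P c)"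
        using finite_gens finite_subset by blast
    qed
  qed auto
  also have "\<dots> = (\<Sum>c\<in>?C. card (dset n w \<phi> S P c))"
    by (intro sum.cong refl card_image) (auto simp: inj_on_def)
  finally show ?thesis .
qed

section \<open>Removing the marked point\<close>

definition unmark :: "nat \<Rightarrow> bword \<Rightarrow> arc \<Rightarrow> nat set \<times> arc set \<Rightarrow> nat set \<times> arc set" where
  "unmark n w m x = (fst x, snd x - cls n w (fst x) m)"

lemma unmark_gens: "x \<in> gens n w \<Longrightarrow> unmark n w m x \<in> gens n w"
proof (cases x)
  case (Pair S P)
  assume "x \<in> gens n w"
  with Pair have g: "(S, P) \<in> gens n w" by simp
  have "(S, P - cls n w S m) \<in> gens n w"
  proof (rule gensI)
    fix a b assume "a \<in> P - cls n w S m" "(a, b) \<in> conn n w S"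
    moreover from this have "(m, b) \<notin> conn n w S"
      using conn_trans[OF _ conn_sym] by blast
    ultimately show "b \<in> P - cls n w S m" using gens_conn[OF g] by blast
  qed (use g in \<open>auto simp: gens_def\<close>)
  with Pair show ?thesis by (simp add: unmark_def)
qed

text \<open>A circle labelled v_- merges to v_- or to zero and splits into v_- v_-, so the arc
  \<open>m\<close> never gets the label v_+: the states with marked circle v_- span a
  subcomplex.\<close>

lemma dcoef_keeps_unmarked:
  assumes wf: "wf_word n w" and d: "dcoef n w (S, P) (S', P')" and m: "m \<in> arcs n w" "m \<notin> P"
  shows "m \<notin> P'"
proof -
  obtain c where c: "c < length w" "c \<notin> S" "S' = insert c S" using d by (auto elim: dcoef_cases)
  note d' = d[unfolded c(3) dcoef_insert_iff[OF wf c(1,2)] Let_def]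
  have g': "(insert c S, P') \<in> gens n w" using d' by blast
  let ?T = "touched w c"
  have T: "?T \<subseteq> arcs n w" using wf c(1) by (rule touched_subset_arcs)
  show ?thesis
  proof (cases "m \<in> \<Union> (cls n w S ` ?T)")
    case False
    then show ?thesis using d' m by blast
  next
    case True
    obtain t where t: "t \<in> ?T" "m \<in> cls n w S t" using True by blast
    obtain t' where t': "t' \<in> ?T" "m \<in> cls n w (insert c S) t'"
      using True Union_cls_insert[OF wf c(1), of S] by blast
    have nt: "\<not> cls n w S t \<subseteq> P" using t m by blast
    have "\<not> cls n w (insert c S) t' \<subseteq> P'"
    proof (cases "card (cls n w S ` ?T) = 2")
      case True
      then show ?thesis using d' nt t t' by force
    next
      case False
      then have "card {C \<in> cls n w (insert c S) ` ?T. C \<subseteq> P'} =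
          (if \<Union> (cls n w S ` ?T) \<subseteq> P then 1 else 0)" using d' by blast
      moreover have "\<not> \<Union> (cls n w S ` ?T) \<subseteq> P" using nt t by blast
      ultimately have "card {C \<in> cls n w (insert c S) ` ?T. C \<subseteq> P'} = 0" by simp
      moreover have "finite {C \<in> cls n w (insert c S) ` ?T. C \<subseteq> P'}" by (simp add: touched_eq)
      ultimately show ?thesis using t' by auto
    qed
    then have "t' \<notin> P'" using gens_cls_subset_iff[OF g'] t' T by blast
    then show ?thesis using gens_conn[OF g', of t' m] t' by blast
  qed
qed

lemma card_2_elem: "card A = 2 \<Longrightarrow> a \<in> A \<Longrightarrow> \<exists>b. A = {a, b} \<and> b \<noteq> a"
  unfolding card_2_iff by auto

text \<open>In the quotient, merging the marked v_+ with v_+ gives v_+ and with v_- gives zero; in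
  the subcomplex, merging the marked v_- with v_+ gives v_- and with v_- gives zero. Splitting the
  marked circle leaves one term in both, with v_- on the new unmarked circle. So the coefficients
  agree.\<close>

lemma dcoef_unmark_iff:
  assumes wf: "wf_word n w" and g: "(S, P) \<in> gens n w" and g': "(S', P') \<in> gens n w"
    and m: "m \<in> P" "m \<in> P'"
  shows "dcoef n w (S, P - cls n w S m) (S', P' - cls n w S' m) \<longleftrightarrow> dcoef n w (S, P) (S', P')"
proof (cases "\<exists>c<length w. c \<notin> S \<and> S' = insert c S")
  case False
  then show ?thesis by (auto elim!: dcoef_cases)
next
  case True
  then obtain c where c: "c < length w" "c \<notin> S" "S' = insert c S" by blast
  let ?T = "touched w c" and ?M = "cls n w S m" and ?M' = "cls n w S' m"
  let ?old = "cls n w S ` ?T" and ?new = "cls n w S' ` ?T"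
  have T: "?T \<subseteq> arcs n w" using wf c(1) by (rule touched_subset_arcs)
  have ma: "m \<in> arcs n w" using g m by (auto simp: gens_def)
  have MP: "?M \<subseteq> P" "?M' \<subseteq> P'" using gens_cls_subset_iff g g' m ma by blast+
  have mM: "m \<in> ?M" "m \<in> ?M'" using mem_cls_self[OF ma] by blast+
  have h: "(S, P - ?M) \<in> gens n w" "(S', P' - ?M') \<in> gens n w"
    using unmark_gens[OF g, of m] unmark_gens[OF g', of m] by (simp_all add: unmark_def)
  have U: "\<Union>?new = \<Union>?old" using Union_cls_insert[OF wf c(1)] c(3) by simp
  have disj: "C = ?M \<or> C \<inter> ?M = {}" if "C \<in> ?old" for C
    using that T quotient_disj[OF equiv_conn[of n w S]] ma by (auto simp: quotient_def)
  have disj': "C = ?M' \<or> C \<inter> ?M' = {}" if "C \<in> ?new" for C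
    using that T quotient_disj[OF equiv_conn[of n w S']] ma by (auto simp: quotient_def)
  have ne: "C \<noteq> {}" if "C \<in> ?old \<union> ?new" for C
    using that T mem_cls_self by blast
  show ?thesis
  proof (cases "m \<in> \<Union>?old")
    \<comment> \<open>The marked circle is away from the crossing and is the same circle before and
      after.\<close>
    case False
    have "?M \<inter> ?T = {}" using False in_Union_cls_iff[OF T ma] by blast
    then have eq: "?M' = ?M" using cls_insert_untouched[OF wf] c(3) by simp
    have o: "C \<inter> ?M = {}" if "C \<in> ?old" for C using False that disj mM by blast
    have o': "C \<inter> ?M = {}" if "C \<in> ?new" for C using False that disj' mM U eq by blast
    have so: "C \<subseteq> P - ?M \<longleftrightarrow> C \<subseteq> P" if "C \<in> ?old" for C using o[OF that] by blast
    have sn: "C \<subseteq> P' - ?M \<longleftrightarrow> C \<subseteq> P'" if "C \<in> ?new" for C using o'[OF that] by blast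
    have sn': "{C \<in> ?new. C \<subseteq> P' - ?M} = {C \<in> ?new. C \<subseteq> P'}" using sn by blast
    have sU: "\<Union>?old \<subseteq> P - ?M \<longleftrightarrow> \<Union>?old \<subseteq> P" using o by blast
    have out: "(\<forall>a \<in> arcs n w. a \<notin> \<Union>?old \<longrightarrow> (a \<in> P - ?M \<longleftrightarrow> a \<in> P' - ?M)) \<longleftrightarrow>
        (\<forall>a \<in> arcs n w. a \<notin> \<Union>?old \<longrightarrow> (a \<in> P \<longleftrightarrow> a \<in> P'))"
      using MP eq by blast
    have e1: "(\<exists>C\<in>?old. C \<subseteq> P - ?M) \<longleftrightarrow> (\<exists>C\<in>?old. C \<subseteq> P)" using so by blast
    have e2: "(\<forall>C\<in>?new. (C \<subseteq> P' - ?M) = (\<forall>D\<in>?old. D \<subseteq> P - ?M)) \<longleftrightarrow>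
        (\<forall>C\<in>?new. (C \<subseteq> P') = (\<forall>D\<in>?old. D \<subseteq> P))"
      using so sn by simp
    show ?thesis
      unfolding eq unfolding c(3) dcoef_insert_iff[OF wf c(1,2)] Let_def
      unfolding c(3)[symmetric]
      by (simp only: g g' h[unfolded eq] out e1 e2 sn' sU simp_thms)
  next
    case True
    have Mo: "?M \<in> ?old" using True disj mM by blast
    have "m \<in> \<Union>?new" using True U by simp
    then obtain C where C: "C \<in> ?new" "m \<in> C" by blast
    with disj'[of C] mM have "C = ?M'" by blast
    with C have Mn: "?M' \<in> ?new" by simp
    have MU: "?M \<subseteq> \<Union>?old" using Mo by blast
    have MU': "?M' \<subseteq> \<Union>?old" unfolding U[symmetric] using Mn by blast
    have out: "(\<forall>a \<in> arcs n w. a \<notin> \<Union>?old \<longrightarrow> (a \<in> P - ?M \<longleftrightarrow> a \<in> P' - ?M')) \<longleftrightarrow>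
        (\<forall>a \<in> arcs n w. a \<notin> \<Union>?old \<longrightarrow> (a \<in> P \<longleftrightarrow> a \<in> P'))"
      using MU MU' by blast
    have merge: "(\<exists>C\<in>?old. C \<subseteq> P - ?M) \<and> (\<forall>C\<in>?new. (C \<subseteq> P' - ?M') = (\<forall>D\<in>?old. D \<subseteq> P - ?M)) \<longleftrightarrow>
        (\<exists>C\<in>?old. C \<subseteq> P) \<and> (\<forall>C\<in>?new. (C \<subseteq> P') = (\<forall>D\<in>?old. D \<subseteq> P))"
      if k: "card ?old = 2" "card ?new = 1"
    proof -
      have n: "?new = {?M'}" using k(2) Mn by (metis card_1_singletonE singletonD)
      obtain D where D: "?old = {?M, D}" "D \<noteq> ?M"
        using card_2_elem[OF k(1) Mo] by blast
      have "D \<inter> ?M = {}" using disj[of D] D by blast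
      then have "D \<subseteq> P - ?M \<longleftrightarrow> D \<subseteq> P" by blast
      moreover have "\<not> ?M \<subseteq> P - ?M" "\<not> ?M' \<subseteq> P' - ?M'" using mM by blast+
      ultimately show ?thesis unfolding n D(1) using MP by simp
    qed
    have split: "card {C\<in>?new. C \<subseteq> P' - ?M'} = (if \<Union>?old \<subseteq> P - ?M then 1 else 0) \<longleftrightarrow>
        card {C\<in>?new. C \<subseteq> P'} = (if \<Union>?old \<subseteq> P then 1 else 0)"
      if k: "card ?old = 1" "card ?new = 2"
    proof -
      have o: "?old = {?M}" using k(1) Mo by (metis card_1_singletonE singletonD)
      obtain D where D: "?new = {?M', D}" "D \<noteq> ?M'"
        using card_2_elem[OF k(2) Mn] by blast
      have D': "D \<inter> ?M' = {}" "D \<noteq> {}" using disj'[of D] ne[of D] D by blast+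
      have "{C\<in>?new. C \<subseteq> P' - ?M'} = (if D \<subseteq> P' then {D} else {})"
        unfolding D(1) using D' MP mM by auto
      moreover have "{C\<in>?new. C \<subseteq> P'} = (if D \<subseteq> P' then {D, ?M'} else {?M'})"
        unfolding D(1) using MP by auto
      ultimately show ?thesis using o MP mM D(2) by auto
    qed
    show ?thesis
      unfolding c(3) dcoef_insert_iff[OF wf c(1,2)] Let_def
      unfolding c(3)[symmetric]
      by (simp only: g g' h out merge split simp_thms cong: conj_cong)
  qed
qed

lemma inj_on_unmark: "inj_on (unmark n w m) (rgens n w m)"
proof (rule inj_onI)
  fix x y assume x: "x \<in> rgens n w m" and y: "y \<in> rgens n w m"
    and eq: "unmark n w m x = unmark n w m y"
  obtain S P where xS: "x = (S, P)" by fastforce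
  obtain P' where yS: "y = (S, P')" using eq xS by (cases y) (auto simp: unmark_def)
  have g: "(S, P) \<in> gens n w" "m \<in> P" "(S, P') \<in> gens n w" "m \<in> P'"
    using x y xS yS by (auto simp: rgens_def)
  then have "m \<in> arcs n w" by (auto simp: gens_def)
  then have "cls n w S m \<subseteq> P" "cls n w S m \<subseteq> P'" using g gens_cls_subset_iff by blast+
  moreover have "P - cls n w S m = P' - cls n w S m" using eq xS yS by (simp add: unmark_def)
  ultimately have "P = P'" by blast
  with xS yS show "x = y" by simp
qed

lemma unmark_surj:
  assumes "y \<in> gens n w" "m \<notin> snd y" "m \<in> arcs n w"
  shows "\<exists>x\<in>rgens n w m. unmark n w m x = y"
proof -
  obtain S P where y: "y = (S, P)" by fastforce
  have g: "(S, P) \<in> gens n w" "m \<notin> P" using assms y by auto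
  have "(S, P \<union> cls n w S m) \<in> gens n w"
  proof (rule gensI)
    fix a b assume "a \<in> P \<union> cls n w S m" "(a, b) \<in> conn n w S"
    then show "b \<in> P \<union> cls n w S m" using gens_conn[OF g(1), of a b] conn_trans[of m a n w S b] by blast
  qed (use g in \<open>auto simp: gens_def conn_def\<close>)
  moreover have "cls n w S m \<inter> P = {}" using gens_conn[OF g(1)] g(2) by blast
  ultimately show ?thesis
    using mem_cls_self[OF assms(3), of S] y
    by (intro bexI[of _ "(S, P \<union> cls n w S m)"]) (auto simp: unmark_def rgens_def)
qed

text \<open>The functional is applied after \<open>unmark\<close>, which sends the generator of psi'
  to the state \<open>(S0, {})\<close> for every \<open>m\<close>.\<close>

theorem psi'_nonzeroI:
  assumes wf: "wf_word n w" and m: "m \<in> arcs n w"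
    and S0: "S0 = {c \<in> {0..<length w}. \<not> snd (w ! c)}"
    and cycle: "\<And>y. \<not> dcoef n w (S0, {}) y"
    and one: "\<phi> (S0, {})"
    and closed: "\<And>z. z \<in> gens n w \<Longrightarrow> even (card {y. \<phi> y \<and> dcoef n w z y})"
  shows "psi'_nonzero n w m"
proof -
  let ?u = "unmark n w m" and ?R = "rgens n w m"
  let ?x0 = "(S0, cls n w S0 m)"
  have x0: "psi_gen n w m = ?x0" unfolding psi_gen_def S0 Let_def ..
  have ux0: "?u ?x0 = (S0, {})" by (simp add: unmark_def)
  have x0R: "?x0 \<in> ?R"
    using m S0 by (auto simp: rgens_def conn_def intro!: gensI conn_refl intro: rtrancl_trans)
  have fR: "finite ?R" using finite_gens by (auto simp: rgens_def)
  have d: "dcoef n w (?u x) (?u y) \<longleftrightarrow> dcoef n w x y" if "x \<in> ?R" "y \<in> ?R" for x y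
    using dcoef_unmark_iff[OF wf, of "fst x" "snd x" "fst y" "snd y" m] that
    by (simp add: unmark_def rgens_def)
  have ev: "even (card {y \<in> ?R. \<phi> (?u y) \<and> dcoef n w x y})" if x: "x \<in> ?R" for x
  proof -
    have img: "?u ` {y \<in> ?R. \<phi> (?u y) \<and> dcoef n w x y} = {y. \<phi> y \<and> dcoef n w (?u x) y}"
    proof (intro set_eqI iffI)
      fix y assume y: "y \<in> {y. \<phi> y \<and> dcoef n w (?u x) y}"
      have "m \<notin> snd (?u x)" using m by (simp add: unmark_def conn_refl)
      then have "m \<notin> snd y"
        using dcoef_keeps_unmarked[OF wf _ m, of "fst (?u x)" "snd (?u x)" "fst y" "snd y"] y by simp
      moreover have "y \<in> gens n w" using y by (simp add: dcoef_def)
      ultimately obtain y' where "y' \<in> ?R" "?u y' = y" using unmark_surj m by blast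
      then show "y \<in> ?u ` {y \<in> ?R. \<phi> (?u y) \<and> dcoef n w x y}" using y d[OF x, of y'] by auto
    qed (use d[OF x] in auto)
    have "inj_on ?u {y \<in> ?R. \<phi> (?u y) \<and> dcoef n w x y}"
      using inj_on_unmark by (rule inj_on_subset) auto
    then have "card {y \<in> ?R. \<phi> (?u y) \<and> dcoef n w x y} = card {y. \<phi> y \<and> dcoef n w (?u x) y}"
      unfolding img[symmetric] by (rule card_image[symmetric])
    moreover have "?u x \<in> gens n w" using x unmark_gens by (auto simp: rgens_def)
    ultimately show ?thesis using closed by simp
  qed
  have "\<not> (\<forall>y \<in> ?R. rdiff_coeff n w m X y \<longleftrightarrow> y = ?x0)" if X: "X \<subseteq> ?R" for X
  proof
    assume *: "\<forall>y \<in> ?R. rdiff_coeff n w m X y \<longleftrightarrow> y = ?x0"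
    have fX: "finite X" using X fR finite_subset by blast
    let ?Y = "{y \<in> ?R. \<phi> (?u y)}"
    \<comment> \<open>Pairs of an \<open>x\<close> in \<open>X\<close> and a \<open>y\<close> in the
      support of the functional, counted in two orders. By \<open>closed\<close> the number is even;
      if the boundary of \<open>X\<close> were \<open>?x0\<close>, exactly one \<open>y\<close>
      would have an odd number of partners.\<close>
    have "(\<Sum>y\<in>?Y. card {x \<in> X. dcoef n w x y}) = (\<Sum>x\<in>X. card {y \<in> ?Y. dcoef n w x y})"
      by (rule sum_multicount_gen[symmetric]) (use fX fR in auto)
    also have "even \<dots>"
      using ev X by (intro dvd_sum) (auto simp: conj_assoc Collect_conj_eq)
    finally have "even (\<Sum>y\<in>?Y. card {x \<in> X. dcoef n w x y})" .
    moreover have "odd (card {x \<in> X. dcoef n w x y}) \<longleftrightarrow> y = ?x0" if "y \<in> ?R" for y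
    proof -
      have "{x \<in> X. x \<in> ?R \<and> dcoef n w x y} = {x \<in> X. dcoef n w x y}" using X by auto
      then show ?thesis using bspec[OF * that] by (simp only: rdiff_coeff_def)
    qed
    then have "{y \<in> ?Y. odd (card {x \<in> X. dcoef n w x y})} = {?x0}"
      using x0R one ux0 by auto
    ultimately show False using fR by (simp add: even_sum_iff)
  qed
  moreover have "rdiff_coeff n w m {?x0} y = False" if "y \<in> ?R" for y
  proof -
    have "\<not> dcoef n w ?x0 y" using d[OF x0R that] ux0 cycle by simp
    then have "{x \<in> {?x0}. x \<in> ?R \<and> dcoef n w x y} = {}" by blast
    then show ?thesis unfolding rdiff_coeff_def by (simp only: card.empty even_zero not_True_eq_False)
  qed
  ultimately show ?thesis unfolding psi'_nonzero_def x0 Let_def by blast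
qed

section \<open>The finite linear system\<close>

text \<open>
  The 13 nodes are the classes of arcs of the positive part that are glued together whatever happens at
  the crossings 1, 2, 5, 7, 10, all other positive crossings being vertical. The Booleans tell which of these
  five crossings are 1-resolved, that is, horizontal. The last two edges are the top and the
  bottom arc of the cup-cap \<open>e\<close>.
\<close>

definition node_edges :: "bool \<Rightarrow> bool \<Rightarrow> bool \<Rightarrow> bool \<Rightarrow> bool \<Rightarrow> (nat \<times> nat) list" where
  "node_edges a b c d e =
     (if a then [(1, 4), (2, 5)] else [(1, 2), (4, 5)]) @
     (if b then [(5, 10), (6, 11)] else [(5, 6), (10, 11)]) @
     (if c then [(6, 11), (7, 12)] else [(6, 7), (11, 12)]) @
     (if d then [(2, 7), (3, 8)] else [(2, 3), (7, 8)]) @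
     (if e then [(3, 8), (1, 9)] else [(3, 1), (8, 9)]) @ [(9, 12), (4, 10)]"

text \<open>One step of a naive union-find: the class of \<open>snd e\<close> takes the name of the
  class of \<open>fst e\<close>. Folding it over the edges computes components in a form that the
  simplifier can evaluate.\<close>

definition relabel :: "nat \<times> nat \<Rightarrow> nat list \<Rightarrow> nat list" where
  "relabel e L = map (\<lambda>x. if x = L ! snd e then L ! fst e else x) L"

lemma length_fold_relabel [simp]: "length (fold relabel es L) = length L"
  by (induction es arbitrary: L) (auto simp: relabel_def)

lemma nth_relabel:
  "i < length L \<Longrightarrow> relabel (a, b) L ! i = (if L ! i = L ! b then L ! a else L ! i)"
  by (simp add: relabel_def)

text \<open>Any equivalence that contains the edges identifies nodes with equal final labels.
  \<open>R\<close> will be "the chosen arcs of the two nodes lie on one circle".\<close>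

lemma fold_relabel_complete:
  assumes "set es \<subseteq> {..<length L} \<times> {..<length L}" "distinct L"
    and "\<And>x y. (x, y) \<in> set es \<Longrightarrow> R x y"
    and refl: "\<And>x. x < length L \<Longrightarrow> R x x"
    and sym: "\<And>x y. R x y \<Longrightarrow> R y x"
    and trans: "\<And>x y z. R x y \<Longrightarrow> R y z \<Longrightarrow> R x z"
    and "x < length L" "y < length L" "fold relabel es L ! x = fold relabel es L ! y"
  shows "R x y"
  using assms(1,3,7-9)
proof (induction es arbitrary: x y rule: rev_induct)
  case Nil
  then show ?case using refl assms(2) by (auto simp: nth_eq_iff_index_eq)
next
  case (snoc e es)
  obtain a b where e: "e = (a, b)" by fastforce
  let ?L = "fold relabel es L"
  have IH: "R s t" if "s < length L" "t < length L" "?L ! s = ?L ! t" for s t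
    using snoc.IH[OF _ _ that] snoc.prems by auto
  have ab: "a < length L" "b < length L" "R a b" using snoc.prems e by auto
  have "(if ?L ! x = ?L ! b then ?L ! a else ?L ! x) = (if ?L ! y = ?L ! b then ?L ! a else ?L ! y)"
    using snoc.prems e by (simp add: nth_relabel)
  \<comment> \<open>The last edge only joins the classes of \<open>a\<close> and \<open>b\<close>:
    equal labels afterwards mean equal labels before, or one node in each of the two
    classes.\<close>
  then consider "?L ! x = ?L ! y" | "?L ! x = ?L ! b" "?L ! a = ?L ! y"
    | "?L ! x = ?L ! a" "?L ! b = ?L ! y"
    by (auto split: if_splits)
  then show ?case
  proof cases
    case 1
    then show ?thesis using IH snoc.prems by blast
  next
    case 2
    then have "R x b" "R a y" using IH snoc.prems ab by blast+
    then show ?thesis using ab sym trans by blast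
  next
    case 3
    then have "R x a" "R b y" using IH snoc.prems ab by blast+
    then show ?thesis using ab trans by blast
  qed
qed

definition label_list :: "bool \<Rightarrow> bool \<Rightarrow> bool \<Rightarrow> bool \<Rightarrow> bool \<Rightarrow> nat list" where
  "label_list a b c d e = fold relabel (node_edges a b c d e) [0,1,2,3,4,5,6,7,8,9,10,11,12]"

text \<open>One row for each resolution of the five crossings. Each class is named by one of its
  nodes.\<close>

lemma label_list_table:
    "label_list True True True True True = [0,1,1,3,1,1,6,1,3,1,1,6,1]"
    "label_list True True True True False = [0,3,3,3,3,3,6,3,3,3,3,6,3]"
    "label_list True True True False True = [0,1,1,1,1,1,6,1,1,1,1,6,1]"
    "label_list True True True False False = [0,2,2,2,2,2,6,7,7,7,2,6,7]"
    "label_list True True False True True = [0,1,1,3,1,1,1,1,3,1,1,1,1]"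
    "label_list True True False True False = [0,3,3,3,3,3,3,3,3,3,3,3,3]"
    "label_list True True False False True = [0,1,1,1,1,1,1,1,1,1,1,1,1]"
    "label_list True True False False False = [0,2,2,2,2,2,6,6,6,6,2,6,6]"
    "label_list True False True True True = [0,1,1,3,1,1,1,1,3,1,1,1,1]"
    "label_list True False True True False = [0,3,3,3,3,3,3,3,3,3,3,3,3]"
    "label_list True False True False True = [0,1,1,1,1,1,1,1,1,1,1,1,1]"
    "label_list True False True False False = [0,2,2,2,2,2,2,7,7,7,2,2,7]"
    "label_list True False False True True = [0,1,2,3,1,2,2,2,3,1,1,1,1]"
    "label_list True False False True False = [0,3,2,3,3,2,2,2,3,3,3,3,3]"
    "label_list True False False False True = [0,1,2,2,1,2,2,2,2,1,1,1,1]"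
    "label_list True False False False False = [0,2,2,2,2,2,2,2,2,2,2,2,2]"
    "label_list False True True True True = [0,1,1,3,4,4,6,1,3,1,4,6,1]"
    "label_list False True True True False = [0,3,3,3,4,4,6,3,3,3,4,6,3]"
    "label_list False True True False True = [0,1,1,1,4,4,6,1,1,1,4,6,1]"
    "label_list False True True False False = [0,1,1,1,4,4,6,7,7,7,4,6,7]"
    "label_list False True False True True = [0,1,1,3,4,4,1,1,3,1,4,1,1]"
    "label_list False True False True False = [0,3,3,3,4,4,3,3,3,3,4,3,3]"
    "label_list False True False False True = [0,1,1,1,4,4,1,1,1,1,4,1,1]"
    "label_list False True False False False = [0,1,1,1,4,4,6,6,6,6,4,6,6]"
    "label_list False False True True True = [0,1,1,3,4,4,4,1,3,1,4,4,1]"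
    "label_list False False True True False = [0,3,3,3,4,4,4,3,3,3,4,4,3]"
    "label_list False False True False True = [0,1,1,1,4,4,4,1,1,1,4,4,1]"
    "label_list False False True False False = [0,1,1,1,4,4,4,7,7,7,4,4,7]"
    "label_list False False False True True = [0,1,1,3,1,1,1,1,3,1,1,1,1]"
    "label_list False False False True False = [0,3,3,3,3,3,3,3,3,3,3,3,3]"
    "label_list False False False False True = [0,1,1,1,1,1,1,1,1,1,1,1,1]"
    "label_list False False False False False = [0,1,1,1,4,4,4,4,4,4,4,4,4]"
  by (simp_all add: label_list_def node_edges_def relabel_def)

text \<open>
  A sparse solution, found by computer, of the equations \<open>\<phi>\<^sub>j \<circ> d = \<phi>\<^sub>j\<^sub>-\<^sub>1 \<circ> (t + b)\<close>, where \<open>\<phi>\<^sub>j\<close> is the part of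
  \<open>phi\<close> with \<open>j\<close> of the five crossings 1-resolved, \<open>t\<close> and \<open>b\<close> multiply the circles through the top
  and the bottom arc of \<open>e\<close> by \<open>v\<^sub>-\<close>, and \<open>\<phi>\<^sub>0 \<circ> (t + b)\<close> has to be replaced by \<open>\<phi>\<^sub>0\<close> composed with the
  saddle \<open>e \<rightarrow> 1\<close>. Here \<open>p\<close> says which nodes lie on circles labelled \<open>v\<^sub>+\<close>.
\<close>

definition phi :: "bool \<Rightarrow> bool \<Rightarrow> bool \<Rightarrow> bool \<Rightarrow> bool \<Rightarrow> (nat \<Rightarrow> bool) \<Rightarrow> bool" where
  "phi a b c d e p \<longleftrightarrow> \<not> p 0 \<and>
     (if \<not> c \<and> \<not> d
      then (b \<or> (a \<longleftrightarrow> e)) \<and> (\<forall>x\<in>{1,2,3,4,5,6,7,8,9,10,11,12}. \<not> p x)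
      else d \<and> e \<and>
        (if \<not> c then a \<and> \<not> b \<and> \<not> p 2 \<and> p 1 \<noteq> p 3
         else (a \<or> \<not> p 4) \<and>
           (if b then p 1 \<and> p 3 \<and> \<not> p 6 \<or> p 1 \<and> \<not> p 3 \<and> p 6 \<or> \<not> p 1 \<and> p 3 \<and> p 6
            else \<not> a \<and> p 1 \<noteq> p 3)))"

lemma phi_cong: "(\<And>x. x < 13 \<Longrightarrow> p x = q x) \<Longrightarrow> phi a b c d e p = phi a b c d e q"
  unfolding phi_def by simp

text \<open>
  The value of \<open>f\<close> on the part of the differential that belongs to one crossing: \<open>L\<close> and \<open>L'\<close> send a node
  to its circle before and after the change, \<open>u\<close> and \<open>v\<close> represent the circles at the crossing
  before, \<open>u\<close> and \<open>w\<close> those after it.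
\<close>

definition flip_parity :: "(nat \<Rightarrow> nat) \<Rightarrow> (nat \<Rightarrow> nat) \<Rightarrow> ((nat \<Rightarrow> bool) \<Rightarrow> bool) \<Rightarrow> nat \<Rightarrow> nat \<Rightarrow> nat \<Rightarrow> (nat \<Rightarrow> bool) \<Rightarrow> bool" where
  "flip_parity L L' f u v w p \<longleftrightarrow>
    (if L u = L v
     then if p u then f (\<lambda>x. p x \<and> L' x \<noteq> L' u) \<noteq> f (\<lambda>x. p x \<and> L' x \<noteq> L' w) else f p
     else p u \<and> p v \<and> f p \<or> p u \<noteq> p v \<and> f (\<lambda>x. p x \<and> L x \<noteq> L u \<and> L x \<noteq> L v))"

text \<open>The right-hand side of the equations. Multiplying a circle by v_- gives zero unless it
  is labelled v_+, and then relabels it v_-; nodes 9 and 4 lie on the top and the bottom arc of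
  \<open>e\<close>. The first branch is the composite with the saddle: only the labelling by v_-
  throughout contributes.\<close>

definition tail_value :: "bool \<Rightarrow> bool \<Rightarrow> bool \<Rightarrow> bool \<Rightarrow> bool \<Rightarrow> (nat \<Rightarrow> bool) \<Rightarrow> bool" where
  "tail_value a b c d e p \<longleftrightarrow>
    (if \<not> (a \<or> b \<or> c \<or> d \<or> e) then phi a b c d e p
     else (p 9 \<and> phi a b c d e (\<lambda>x. p x \<and> label_list a b c d e ! x \<noteq> label_list a b c d e ! 9)) \<noteq>
          (p 4 \<and> phi a b c d e (\<lambda>x. p x \<and> label_list a b c d e ! x \<noteq> label_list a b c d e ! 4)))"

text \<open>\<open>v\<close> is an arbitrary labelling of the circles. For each crossing, the three
  nodes are those of its top left, top right and bottom left arc.\<close>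

lemma label_list_flip_parity_sum:
  fixes a b c d e v
  defines "p \<equiv> \<lambda>x. v (label_list a b c d e ! x)"
  shows "((\<not> a \<and> flip_parity ((!) (label_list a b c d e)) ((!) (label_list True b c d e)) (phi True b c d e) 1 4 2 p) \<noteq>
    ((\<not> b \<and> flip_parity ((!) (label_list a b c d e)) ((!) (label_list a True c d e)) (phi a True c d e) 5 10 6 p) \<noteq>
    ((\<not> c \<and> flip_parity ((!) (label_list a b c d e)) ((!) (label_list a b True d e)) (phi a b True d e) 6 11 7 p) \<noteq>
    ((\<not> d \<and> flip_parity ((!) (label_list a b c d e)) ((!) (label_list a b c True e)) (phi a b c True e) 2 7 3 p) \<noteq>
     (\<not> e \<and> flip_parity ((!) (label_list a b c d e)) ((!) (label_list a b c d True)) (phi a b c d True) 3 8 1 p)))))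
    \<longleftrightarrow> tail_value a b c d e p"
  unfolding p_def
  \<comment> \<open>Only 0, 1, 2, 3, 4, 6 and 7 occur as class names in the table, so these are the
    values of \<open>v\<close> to be distinguished.\<close>
  by (cases a; cases b; cases c; cases d; cases e;
     simp only: flip_parity_def tail_value_def label_list_table phi_def simp_thms if_True if_False;
     simp split del: if_split; cases "v 0"; simp?; cases "v 1"; simp?; cases "v 2"; simp?; cases "v 3"; simp?;
     cases "v 4"; simp?; cases "v 6"; simp?; cases "v 7"; simp)

section \<open>Resolutions of the closed braid\<close>

lemma length_beta_word: "length (beta_word k) = 12 + k"
  by (simp add: beta_word_def delta2_word_def numeral_eq_Suc)

lemma delta2_word_eq: "delta2_word = [(1, True), (2, True), (3, True), (1, True), (2, True), (3, True),
   (1, True), (2, True), (3, True), (1, True), (2, True), (3, True)]"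
  by (simp add: delta2_word_def numeral_eq_Suc)

lemma less_12_cases:
  assumes "c < (12::nat)"
  shows "c = 0 \<or> c = 1 \<or> c = 2 \<or> c = 3 \<or> c = 4 \<or> c = 5 \<or> c = 6 \<or> c = 7 \<or> c = 8 \<or>
    c = 9 \<or> c = 10 \<or> c = 11"
  using assms by presburger

lemma beta_word_nth_head: "c < 12 \<Longrightarrow> beta_word k ! c = (Suc (c mod 3), True)"
  by (drule less_12_cases, elim disjE) (simp_all add: beta_word_def delta2_word_eq nth_append)

lemma beta_word_nth_tail: "i < k \<Longrightarrow> beta_word k ! (12 + i) = (3, False)"
  by (simp add: beta_word_def delta2_word_eq nth_append)

lemma beta_word_nth_tail': "12 \<le> c \<Longrightarrow> c < 12 + k \<Longrightarrow> beta_word k ! c = (3, False)"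
  using beta_word_nth_tail[of "c - 12" k] by simp

lemma wf_beta_word: "wf_word 4 (beta_word k)"
proof -
  have "1 \<le> fst (beta_word k ! c) \<and> fst (beta_word k ! c) < 4" if "c < 12 + k" for c
  proof (cases "c < 12")
    case True
    have "c mod 3 < 3" by simp
    then show ?thesis unfolding beta_word_nth_head[OF True] fst_conv by linarith
  next
    case False
    then show ?thesis using that by (simp add: beta_word_nth_tail')
  qed
  moreover have "beta_word k \<noteq> []" by (simp add: beta_word_def delta2_word_eq)
  ultimately show ?thesis by (simp add: wf_word_def length_beta_word)
qed

lemma nlev_beta_word: "nlev (beta_word k) = 12 + k"
  using nlev_eq_length[OF wf_beta_word] length_beta_word by simp

lemma arcs_beta_word: "arcs 4 (beta_word k) = {0..<12 + k} \<times> {0..<4}"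
  by (simp add: arcs_def nlev_beta_word)

text \<open>Nodes from 13 on are the small circles of the tail. Each is a circle by itself and keeps
  its name.\<close>

definition lab :: "nat set \<Rightarrow> nat \<Rightarrow> nat" where
  "lab S x = (if x < 13 then label_list (1 \<in> S) (2 \<in> S) (5 \<in> S) (7 \<in> S) (10 \<in> S) ! x else x)"

text \<open>The converse of \<open>fold_relabel_complete\<close>, read off from the table: nodes
  that are glued share a label.\<close>

lemma lab_edges:
  "lab S 1 = lab S (if 1 \<in> S then 4 else 2)" "lab S 5 = lab S (if 1 \<in> S then 2 else 4)"
  "lab S 5 = lab S (if 2 \<in> S then 10 else 6)" "lab S 11 = lab S (if 2 \<in> S then 6 else 10)"
  "lab S 6 = lab S (if 5 \<in> S then 11 else 7)" "lab S 12 = lab S (if 5 \<in> S then 7 else 11)"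
  "lab S 2 = lab S (if 7 \<in> S then 7 else 3)" "lab S 8 = lab S (if 7 \<in> S then 3 else 7)"
  "lab S 3 = lab S (if 10 \<in> S then 8 else 1)" "lab S 9 = lab S (if 10 \<in> S then 1 else 8)"
  "lab S 9 = lab S 12" "lab S 4 = lab S 10"
  unfolding lab_def
  by (cases "1 \<in> S"; cases "2 \<in> S"; cases "5 \<in> S"; cases "7 \<in> S"; cases "10 \<in> S";
      simp add: label_list_table)+

lemma lab_less: "lab S x < 13 \<longleftrightarrow> x < 13"
proof -
  have "\<forall>y \<in> set (label_list a b c d e). y < 13" for a b c d e
    by (cases a; cases b; cases c; cases d; cases e; simp add: label_list_table)
  moreover have "length (label_list a b c d e) = 13" for a b c d e
    by (simp add: label_list_def)
  ultimately have "label_list a b c d e ! x < 13" if "x < 13" for a b c d e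
    using that nth_mem by metis
  then show ?thesis by (simp add: lab_def)
qed

text \<open>Rows are strand positions, columns are levels 0 to 12. A new node begins exactly below
  each of the five crossings on the strand. Row 1 returns to node 1, since strand 1 runs straight
  through the tail; rows 2 and 3 end at 9 and 12 instead of 4 and 10, because the tail lies in
  between.\<close>

definition head_node :: "nat \<Rightarrow> nat \<Rightarrow> nat" where
  "head_node l q =
    [[0, 0, 0, 0, 0, 0, 0, 0, 0, 0, 0, 0, 0],
     [1, 1, 2, 2, 2, 2, 2, 2, 3, 3, 3, 1, 1],
     [4, 4, 5, 6, 6, 6, 7, 7, 8, 8, 8, 9, 9],
     [10, 10, 10, 11, 11, 11, 12, 12, 12, 12, 12, 12, 12]] ! q ! l"

definition cnt :: "nat set \<Rightarrow> nat \<Rightarrow> nat" where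
  "cnt Z i = card (Z \<inter> {..<i})"

text \<open>
  \<open>Z\<close> is the set of 0-resolved negative crossings. The small circle below the \<open>n\<close>-th of them, for
  \<open>0 < n < card Z\<close>, becomes the node \<open>12 + n\<close>.
\<close>

definition tail_node :: "nat set \<Rightarrow> nat \<Rightarrow> nat \<Rightarrow> nat" where
  "tail_node Z i q =
    (if q < 2 then q
     else if cnt Z i = 0 then (if q = 2 then 9 else 12)
     else if cnt Z i = card Z then (if q = 2 then 4 else 10)
     else 12 + cnt Z i)"

definition node :: "nat set \<Rightarrow> arc \<Rightarrow> nat" where
  "node Z a = (if fst a < 12 then head_node (fst a) (snd a) else tail_node Z (fst a - 12) (snd a))"

text \<open>The topmost arc of each node.\<close>

definition rep :: "nat \<Rightarrow> arc" where
  "rep x = [(0, 0), (0, 1), (2, 1), (8, 1), (0, 2), (2, 2), (3, 2), (6, 2), (8, 2), (11, 2),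
     (0, 3), (3, 3), (6, 3)] ! x"

definition zeros :: "nat \<Rightarrow> nat set \<Rightarrow> nat set" where
  "zeros k S = {i. i < k \<and> 12 + i \<notin> S}"

section \<open>Counting the 0-resolved negative crossings; nodes level by level\<close>

lemma finite_zeros [simp]: "finite (zeros k S)"
  by (simp add: zeros_def)

lemma cnt_0 [simp]: "cnt Z 0 = 0"
  by (simp add: cnt_def)

lemma cnt_Suc: "finite Z \<Longrightarrow> cnt Z (Suc i) = (if i \<in> Z then Suc (cnt Z i) else cnt Z i)"
proof -
  assume "finite Z"
  have "Z \<inter> {..<Suc i} = (if i \<in> Z then insert i (Z \<inter> {..<i}) else Z \<inter> {..<i})"
    by (auto simp: less_Suc_eq)
  then show ?thesis using \<open>finite Z\<close> by (simp add: cnt_def)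
qed

lemma cnt_eq_card: "Z \<subseteq> {..<k} \<Longrightarrow> cnt Z k = card Z"
  by (simp add: cnt_def Int_absorb2)

lemma cnt_mono: "finite Z \<Longrightarrow> i \<le> j \<Longrightarrow> cnt Z i \<le> cnt Z j"
  unfolding cnt_def by (intro card_mono) auto

lemma cnt_le_card: "finite Z \<Longrightarrow> cnt Z i \<le> card Z"
  unfolding cnt_def by (intro card_mono) auto

lemma cnt_less_card: "finite Z \<Longrightarrow> i \<in> Z \<Longrightarrow> cnt Z i < card Z"
  unfolding cnt_def by (intro psubset_card_mono) auto

lemma cnt_eq_imp_disjoint:
  assumes "finite Z" "cnt Z i = cnt Z j"
  shows "Z \<inter> {i..<j} = {}"
proof (rule ccontr)
  assume "Z \<inter> {i..<j} \<noteq> {}"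
  then obtain z where z: "z \<in> Z" "i \<le> z" "z < j" by auto
  have "cnt Z i \<le> cnt Z z" using cnt_mono[OF assms(1) z(2)] .
  also have "\<dots> < cnt Z (Suc z)" using z assms by (simp add: cnt_Suc)
  also have "\<dots> \<le> cnt Z j" using cnt_mono[OF assms(1)] z by simp
  finally show False using assms(2) by simp
qed

lemma head_node_12: "q < 4 \<Longrightarrow> head_node 12 q = tail_node Z 0 q"
proof -
  assume "q < 4"
  then have "q = 0 \<or> q = 1 \<or> q = 2 \<or> q = 3" by linarith
  then show ?thesis by (elim disjE) (simp_all add: head_node_def tail_node_def)
qed

lemma node_le_12: "l \<le> 12 \<Longrightarrow> q < 4 \<Longrightarrow> node Z (l, q) = head_node l q"
  using head_node_12[of q Z] by (cases "l = 12") (simp_all add: node_def)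

lemma head_node_step:
  assumes "c < 12" "q < 4" "c \<notin> {1, 2, 5, 7, 10} \<or> q \<noteq> c mod 3 \<and> q \<noteq> Suc (c mod 3)"
  shows "head_node c q = head_node (Suc c) q"
proof -
  have "q = 0 \<or> q = 1 \<or> q = 2 \<or> q = 3" using assms(2) by linarith
  then show ?thesis using less_12_cases[OF assms(1)] assms(3)
    by (elim disjE) (simp_all add: head_node_def)
qed

lemma head_node_step_conv:
  assumes "c < 12" "q < 4" "head_node c q = head_node (Suc c) q"
  shows "c \<notin> {1, 2, 5, 7, 10} \<or> q \<noteq> c mod 3 \<and> q \<noteq> Suc (c mod 3)"
proof -
  have "q = 0 \<or> q = 1 \<or> q = 2 \<or> q = 3" using assms(2) by linarith
  then show ?thesis using less_12_cases[OF assms(1)] assms(3)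
    by (elim disjE) (simp_all add: head_node_def)
qed

text \<open>The exception is strand 1 below crossing 10: it is back on node 1, whose chosen arc is
  at level 0.\<close>

lemma rep_head_node_new:
  assumes "l < 12" "q < 4" "head_node l q \<noteq> head_node (Suc l) q" "\<not> (l = 10 \<and> q = 1)"
  shows "rep (head_node (Suc l) q) = (Suc l, q)"
proof -
  have "q = 0 \<or> q = 1 \<or> q = 2 \<or> q = 3" using assms(2) by linarith
  then show ?thesis using less_12_cases[OF assms(1)] assms(3,4)
    by (elim disjE) (simp_all add: head_node_def rep_def)
qed

text \<open>Some negative crossing is 0-resolved, so the tail really contains a cup and a cap and
  the edges (9, 12) and (4, 10) of the node graph are present. States from which the differential
  can reach the support of the cocycle satisfy this, having one more 0-resolved negative crossing
  than 1-resolved positive ones.\<close>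

locale beta_state =
  fixes k :: nat and S :: "nat set"
  assumes S: "S \<subseteq> {0..<12 + k}" and active: "S \<inter> {..<12} \<subseteq> {1, 2, 5, 7, 10}"
    and zeros_ne: "zeros k S \<noteq> {}"
begin

abbreviation "w \<equiv> beta_word k"
abbreviation "Z \<equiv> zeros k S"
abbreviation "cn \<equiv> conn 4 w S"

text \<open>\<open>lv i\<close> is the level of the arcs above the \<open>i\<close>-th negative crossing; \<open>lv k = 0\<close>.\<close>

definition "lv i = (12 + i) mod (12 + k)"

lemma k_pos: "0 < k" using zeros_ne by (auto simp: zeros_def)

lemma Z_subset: "Z \<subseteq> {..<k}" by (auto simp: zeros_def)

lemma lv_less: "i < k \<Longrightarrow> lv i = 12 + i" and lv_k: "lv k = 0"
  by (simp_all add: lv_def)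

lemma Suc_mod: "(13 + i) mod nlev w = lv (Suc i)"
  by (simp add: lv_def nlev_beta_word)

lemma node_lv: "i \<le> k \<Longrightarrow> q < 4 \<Longrightarrow> node Z (lv i, q) = tail_node Z i q"
proof (cases "i = k")
  case True
  assume q: "q < 4"
  have "q = 0 \<or> q = 1 \<or> q = 2 \<or> q = 3" using q by linarith
  then show ?thesis
    using True cnt_eq_card[OF Z_subset]
    by (elim disjE) (simp_all add: zeros_ne lv_k node_def head_node_def tail_node_def)
qed (simp add: lv_less node_def)

lemma cedges_head:
  assumes "c < 12"
  shows "cedges 4 w S c = {((c, q), (Suc c, q)) | q. q < 4 \<and> q \<noteq> c mod 3 \<and> q \<noteq> Suc (c mod 3)} \<union>
    (if c \<notin> S then {((c, c mod 3), (Suc c, c mod 3)), ((c, Suc (c mod 3)), (Suc c, Suc (c mod 3)))}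
     else {((c, c mod 3), (c, Suc (c mod 3))), ((Suc c, c mod 3), (Suc c, Suc (c mod 3)))})"
proof -
  have "Suc c mod nlev w = Suc c" using assms k_pos by (simp add: nlev_beta_word)
  then show ?thesis using assms by (simp add: cedges_def vert_def Let_def beta_word_nth_head)
qed

lemma cedges_tail:
  assumes "i < k"
  shows "cedges 4 w S (12 + i) = {((lv i, q), (lv (Suc i), q)) | q. q < 2} \<union>
    (if i \<notin> Z then {((lv i, 2), (lv (Suc i), 2)), ((lv i, 3), (lv (Suc i), 3))}
     else {((lv i, 2), (lv i, 3)), ((lv (Suc i), 2), (lv (Suc i), 3))})"
proof -
  have "{((12 + i, q), (lv (Suc i), q)) | q. q < 4 \<and> q \<noteq> 2 \<and> q \<noteq> Suc 2} =
      {((lv i, q), (lv (Suc i), q)) | q. q < 2}"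
    using assms by (auto simp: lv_less)
  moreover have "12 + i \<in> S \<longleftrightarrow> i \<notin> Z" using assms by (simp add: zeros_def)
  ultimately show ?thesis
    using assms
    by (simp add: cedges_def vert_def Let_def beta_word_nth_tail Suc_mod lv_less flip: numeral_3_eq_3 numeral_2_eq_2)
qed

lemma not_active: "c < 12 \<Longrightarrow> c \<notin> {1, 2, 5, 7, 10} \<Longrightarrow> c \<notin> S"
  using active by blast

lemma conn_sound:
  assumes "c < length w" "(a, b) \<in> cedges 4 w S c"
  shows "lab S (node Z a) = lab S (node Z b)"
proof (cases "c < 12")
  case True
  show ?thesis
  proof (cases "fst a \<noteq> fst b \<and> (snd a = snd b) \<and> (c \<notin> {1, 2, 5, 7, 10} \<or> snd a \<noteq> c mod 3 \<and> snd a \<noteq> Suc (c mod 3))")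
    case vert: True
    then have "a = (c, snd a)" "b = (Suc c, snd a)" "snd a < 4"
      using assms(2) not_active[OF True] unfolding cedges_head[OF True] by (auto split: if_splits)
    then have "node Z a = node Z b"
      using head_node_step[OF True, of "snd a"] node_le_12[of c "snd a" Z] node_le_12[of "Suc c" "snd a" Z] True vert
      by (metis Suc_leI less_imp_le_nat)
    then show ?thesis by simp
  next
    case False
    \<comment> \<open>Any other edge belongs to one of the five crossings, as the remaining positive
      crossings are vertical and do not change the node.\<close>
    then have c: "c = 1 \<or> c = 2 \<or> c = 5 \<or> c = 7 \<or> c = 10"
      using assms(2) not_active[OF True] unfolding cedges_head[OF True] by (auto split: if_splits)
    have ab: "(a, b) \<in> (if c \<notin> S then {((c, c mod 3), (Suc c, c mod 3)), ((c, Suc (c mod 3)), (Suc c, Suc (c mod 3)))}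
     else {((c, c mod 3), (c, Suc (c mod 3))), ((Suc c, c mod 3), (Suc c, Suc (c mod 3)))})"
      using assms(2) False unfolding cedges_head[OF True] by auto
    from c show ?thesis
    proof (elim disjE)
      assume "c = 1" then show ?thesis using ab lab_edges(1,2)[of S]
        by (cases "1 \<in> S") (auto simp: node_def head_node_def)
    next
      assume "c = 2" then show ?thesis using ab lab_edges(3,4)[of S]
        by (cases "2 \<in> S") (auto simp: node_def head_node_def)
    next
      assume "c = 5" then show ?thesis using ab lab_edges(5,6)[of S]
        by (cases "5 \<in> S") (auto simp: node_def head_node_def)
    next
      assume "c = 7" then show ?thesis using ab lab_edges(7,8)[of S]
        by (cases "7 \<in> S") (auto simp: node_def head_node_def)
    next
      assume "c = 10" then show ?thesis using ab lab_edges(9,10)[of S]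
        by (cases "10 \<in> S") (auto simp: node_def head_node_def)
    qed
  qed
next
  case False
  define i where "i = c - 12"
  have i: "i < k" "c = 12 + i" using False assms(1) by (auto simp: i_def length_beta_word)
  have le: "i \<le> k" "Suc i \<le> k" using i by auto
  have cS: "cnt Z (Suc i) = (if i \<in> Z then Suc (cnt Z i) else cnt Z i)" by (simp add: cnt_Suc)
  have lt: "i \<in> Z \<Longrightarrow> cnt Z i < card Z" by (simp add: cnt_less_card)
  from assms(2) consider
    q where "q < 2" "a = (lv i, q)" "b = (lv (Suc i), q)"
    | q where "q \<in> {2, 3}" "i \<notin> Z" "a = (lv i, q)" "b = (lv (Suc i), q)"
    | "i \<in> Z" "a = (lv i, 2)" "b = (lv i, 3)"
    | "i \<in> Z" "a = (lv (Suc i), 2)" "b = (lv (Suc i), 3)"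
    unfolding i(2) cedges_tail[OF i(1)] by (auto split: if_splits)
  then show ?thesis
  proof cases
    case 1
    then show ?thesis using le by (simp add: node_lv tail_node_def)
  next
    case (2 q)
    then have "q < 4" by auto
    then show ?thesis using 2 le cS by (simp add: node_lv tail_node_def)
  next
    case 3
    then show ?thesis using le lt lab_edges(11)[of S] by (simp add: node_lv tail_node_def)
  next
    case 4
    then show ?thesis using le lt cS lab_edges(12)[of S] by (simp add: node_lv tail_node_def)
  qed
qed

lemma conn_edge: "c < 12 + k \<Longrightarrow> (a, b) \<in> cedges 4 w S c \<Longrightarrow> (a, b) \<in> cn"
  by (rule conn_cedge[OF wf_beta_word]) (simp_all add: length_beta_word)

lemma conn_tail_chain:
  assumes "i \<le> j" "j \<le> k" "q < 4" "q < 2 \<or> Z \<inter> {i..<j} = {}"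
  shows "((lv i, q), (lv j, q)) \<in> cn"
  using assms
proof (induction j rule: dec_induct)
  case base
  then show ?case by (intro conn_refl) (simp add: arcs_beta_word lv_def)
next
  case (step j)
  have "q < 2 \<or> Z \<inter> {i..<j} = {}" using step.prems by fastforce
  then have "((lv i, q), (lv j, q)) \<in> cn" using step by simp
  moreover have "j < k" using step by simp
  have "((lv j, q), (lv (Suc j), q)) \<in> cn"
  proof (rule conn_edge)
    show "12 + j < 12 + k" using \<open>j < k\<close> by simp
    have "q < 2 \<or> q = 2 \<or> q = 3" using step by auto
    moreover have "q < 2 \<or> j \<notin> Z" using step by auto
    ultimately show "((lv j, q), (lv (Suc j), q)) \<in> cedges 4 w S (12 + j)"
      unfolding cedges_tail[OF \<open>j < k\<close>] by auto
  qed
  ultimately show ?case by (rule conn_trans)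
qed

lemma conn_tail_horiz:
  assumes "i \<in> Z"
  shows "((lv i, 2), (lv i, 3)) \<in> cn" "((lv (Suc i), 2), (lv (Suc i), 3)) \<in> cn"
proof -
  have i: "i < k" using assms Z_subset by auto
  then have "12 + i < 12 + k" by simp
  then show "((lv i, 2), (lv i, 3)) \<in> cn" "((lv (Suc i), 2), (lv (Suc i), 3)) \<in> cn"
    by (rule conn_edge, simp add: cedges_tail[OF i] assms)+
qed

lemma conn_head_step:
  assumes c: "c < 12" "q < 4" "head_node c q = head_node (Suc c) q"
  shows "((c, q), (Suc c, q)) \<in> cn"
proof (rule conn_edge)
  show "c < 12 + k" using c by simp
  have "c \<notin> S \<or> q \<noteq> c mod 3 \<and> q \<noteq> Suc (c mod 3)"
    using head_node_step_conv[OF c] not_active[OF c(1)] by blast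
  then show "((c, q), (Suc c, q)) \<in> cedges 4 w S c"
    unfolding cedges_head[OF c(1)] using c(2) by auto
qed

lemma conn_head_rep:
  assumes "l \<le> 12" "q < 4"
  shows "((l, q), rep (head_node l q)) \<in> cn"
  using assms
proof (induction l)
  case 0
  then have "q = 0 \<or> q = 1 \<or> q = 2 \<or> q = 3" by linarith
  then have "rep (head_node 0 q) = (0, q)" by (elim disjE) (simp_all add: rep_def head_node_def)
  then show ?case using 0 by (simp add: conn_refl arcs_beta_word)
next
  case (Suc l)
  then have l: "l < 12" by simp
  show ?case
  proof (cases "head_node l q = head_node (Suc l) q")
    case True
    then show ?thesis
      using conn_head_step[OF l \<open>q < 4\<close>] Suc conn_sym conn_trans by (metis Suc_leD)
  next
    case False
    show ?thesis
    proof (cases "l = 10 \<and> q = 1")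
      case True
      have "((11, 1), (12, 1)) \<in> cn" using conn_head_step[of 11 1] by (simp add: head_node_def)
      \<comment> \<open>Strand 1 is followed down the whole tail and around the closure to level
        0.\<close>
      moreover have "((12, 1), (0, 1)) \<in> cn"
        using conn_tail_chain[of 0 k 1] lv_less[of 0] lv_k k_pos by simp
      ultimately have "((11, 1), (0, 1)) \<in> cn" by (rule conn_trans)
      then show ?thesis using True by (simp add: head_node_def rep_def)
    next
      case no: False
      have "rep (head_node (Suc l) q) = (Suc l, q)" using rep_head_node_new[OF l \<open>q < 4\<close> False no] .
      then show ?thesis using Suc k_pos by (simp add: conn_refl arcs_beta_word)
    qed
  qed
qed

text \<open>Follow both columns down to the next 0-resolved crossing, where they are joined; if
  there is none below, follow them up to the last one, which exists by
  \<open>zeros_ne\<close>.\<close>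

lemma conn_tail_cols:
  assumes "i \<le> k"
  shows "((lv i, 2), (lv i, 3)) \<in> cn"
proof (cases "Z \<inter> {i..<k} = {}")
  case False
  define z where "z = Min (Z \<inter> {i..<k})"
  have z: "z \<in> Z" "i \<le> z" "z < k" using Min_in[OF _ False] by (auto simp: z_def)
  have "Z \<inter> {i..<z} = {}"
  proof (rule ccontr)
    assume "Z \<inter> {i..<z} \<noteq> {}"
    then obtain y where "y \<in> Z" "i \<le> y" "y < z" by auto
    then have "z \<le> y" using z unfolding z_def by (intro Min_le) auto
    with \<open>y < z\<close> show False by simp
  qed
  then have "((lv i, 2), (lv z, 2)) \<in> cn" "((lv i, 3), (lv z, 3)) \<in> cn"
    using conn_tail_chain[of i z] z by auto
  then show ?thesis using conn_tail_horiz(1)[OF z(1)] conn_sym conn_trans by metis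
next
  case True
  define z where "z = Max Z"
  have z: "z \<in> Z" using Max_in[OF _ zeros_ne] by (simp add: z_def)
  then have "z < k" using Z_subset by auto
  then have zi: "Suc z \<le> i" using z True by fastforce
  have "Z \<inter> {Suc z..<i} = {}"
  proof (rule ccontr)
    assume "Z \<inter> {Suc z..<i} \<noteq> {}"
    then obtain y where "y \<in> Z" "z < y" by (auto simp: Suc_le_eq)
    moreover then have "y \<le> z" unfolding z_def by (intro Max_ge) auto
    ultimately show False by simp
  qed
  then have "((lv (Suc z), 2), (lv i, 2)) \<in> cn" "((lv (Suc z), 3), (lv i, 3)) \<in> cn"
    using conn_tail_chain[OF zi assms] by auto
  then show ?thesis using conn_tail_horiz(2)[OF z(1)] conn_sym conn_trans by metis
qed

lemma conn_rep_head_edge: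
  assumes "c < 12" "((l, q), (l', q')) \<in> cedges 4 w S c" "l \<le> 12" "l' \<le> 12" "q < 4" "q' < 4"
  shows "(rep (head_node l q), rep (head_node l' q')) \<in> cn"
proof -
  have "((l, q), (l', q')) \<in> cn" using assms by (intro conn_edge[of c]) auto
  then show ?thesis
    using conn_head_rep[of l q] conn_head_rep[of l' q'] assms conn_sym conn_trans by metis
qed

lemma conn_rep_active_edge:
  assumes "c \<in> {1, 2, 5, 7, 10}"
  shows "c \<notin> S \<Longrightarrow> (rep (head_node c (c mod 3)), rep (head_node (Suc c) (c mod 3))) \<in> cn"
    and "c \<notin> S \<Longrightarrow> (rep (head_node c (Suc (c mod 3))), rep (head_node (Suc c) (Suc (c mod 3)))) \<in> cn"
    and "c \<in> S \<Longrightarrow> (rep (head_node c (c mod 3)), rep (head_node c (Suc (c mod 3)))) \<in> cn"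
    and "c \<in> S \<Longrightarrow> (rep (head_node (Suc c) (c mod 3)), rep (head_node (Suc c) (Suc (c mod 3)))) \<in> cn"
proof -
  have c: "c < 12" and p: "Suc (c mod 3) < 4" using assms by auto
  show "c \<notin> S \<Longrightarrow> (rep (head_node c (c mod 3)), rep (head_node (Suc c) (c mod 3))) \<in> cn"
    and "c \<notin> S \<Longrightarrow> (rep (head_node c (Suc (c mod 3))), rep (head_node (Suc c) (Suc (c mod 3)))) \<in> cn"
    and "c \<in> S \<Longrightarrow> (rep (head_node c (c mod 3)), rep (head_node c (Suc (c mod 3)))) \<in> cn"
    and "c \<in> S \<Longrightarrow> (rep (head_node (Suc c) (c mod 3)), rep (head_node (Suc c) (Suc (c mod 3)))) \<in> cn"
    by (rule conn_rep_head_edge[OF c]; use c p in \<open>simp add: cedges_head\<close>)+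
qed

lemma conn_rep_edge:
  assumes "(x, y) \<in> set (node_edges (1 \<in> S) (2 \<in> S) (5 \<in> S) (7 \<in> S) (10 \<in> S))"
  shows "(rep x, rep y) \<in> cn"
proof -
  \<comment> \<open>Top and bottom arc of \<open>e\<close>: columns 2 and 3 are joined at the upper
    end of the tail, level 12, and at its lower end, which the closure makes level 0.\<close>
  have t: "(rep 9, rep 12) \<in> cn"
  proof -
    have 1: "((12, 2), rep 9) \<in> cn" using conn_head_rep[of 12 2] by (simp add: head_node_def)
    have 2: "((12, 3), rep 12) \<in> cn" using conn_head_rep[of 12 3] by (simp add: head_node_def)
    have 3: "((12, 2), (12, 3)) \<in> cn" using conn_tail_cols[of 0] lv_less[OF k_pos] by simp
    show ?thesis by (rule conn_trans[OF conn_sym[OF 1] conn_trans[OF 3 2]])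
  qed
  have b: "(rep 4, rep 10) \<in> cn"
    using conn_tail_cols[of k] lv_k by (simp add: rep_def)
  have e1: "1 \<notin> S \<Longrightarrow> (rep 1, rep 2) \<in> cn" "1 \<notin> S \<Longrightarrow> (rep 4, rep 5) \<in> cn"
    "1 \<in> S \<Longrightarrow> (rep 1, rep 4) \<in> cn" "1 \<in> S \<Longrightarrow> (rep 2, rep 5) \<in> cn"
    using conn_rep_active_edge[of 1] by (simp_all add: head_node_def)
  have e2: "2 \<notin> S \<Longrightarrow> (rep 5, rep 6) \<in> cn" "2 \<notin> S \<Longrightarrow> (rep 10, rep 11) \<in> cn"
    "2 \<in> S \<Longrightarrow> (rep 5, rep 10) \<in> cn" "2 \<in> S \<Longrightarrow> (rep 6, rep 11) \<in> cn"
    using conn_rep_active_edge[of 2] by (simp_all add: head_node_def)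
  have e5: "5 \<notin> S \<Longrightarrow> (rep 6, rep 7) \<in> cn" "5 \<notin> S \<Longrightarrow> (rep 11, rep 12) \<in> cn"
    "5 \<in> S \<Longrightarrow> (rep 6, rep 11) \<in> cn" "5 \<in> S \<Longrightarrow> (rep 7, rep 12) \<in> cn"
    using conn_rep_active_edge[of 5] by (simp_all add: head_node_def)
  have e7: "7 \<notin> S \<Longrightarrow> (rep 2, rep 3) \<in> cn" "7 \<notin> S \<Longrightarrow> (rep 7, rep 8) \<in> cn"
    "7 \<in> S \<Longrightarrow> (rep 2, rep 7) \<in> cn" "7 \<in> S \<Longrightarrow> (rep 3, rep 8) \<in> cn"
    using conn_rep_active_edge[of 7] by (simp_all add: head_node_def)
  have e10: "10 \<notin> S \<Longrightarrow> (rep 3, rep 1) \<in> cn" "10 \<notin> S \<Longrightarrow> (rep 8, rep 9) \<in> cn"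
    "10 \<in> S \<Longrightarrow> (rep 3, rep 8) \<in> cn" "10 \<in> S \<Longrightarrow> (rep 1, rep 9) \<in> cn"
    using conn_rep_active_edge[of 10] by (simp_all add: head_node_def)
  show ?thesis
    using assms unfolding node_edges_def
    by (auto simp: t b e1 e2 e5 e7 e10 simp del: One_nat_def split: if_splits)
qed

lemma conn_rep:
  assumes "x < 13" "y < 13" "lab S x = lab S y"
  shows "(rep x, rep y) \<in> cn"
proof -
  let ?es = "node_edges (1 \<in> S) (2 \<in> S) (5 \<in> S) (7 \<in> S) (10 \<in> S)"
  let ?L = "[0,1,2,3,4,5,6,7,8,9,10,11,12] :: nat list"
  show ?thesis
  proof (rule fold_relabel_complete[of ?es ?L "\<lambda>x y. (rep x, rep y) \<in> cn"])
    show "set ?es \<subseteq> {..<length ?L} \<times> {..<length ?L}"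
      by (auto simp: node_edges_def split: if_splits)
    show "(rep x, rep x) \<in> cn" if "x < length ?L" for x
    proof (rule conn_refl)
      have "x = 0 \<or> x = 1 \<or> x = 2 \<or> x = 3 \<or> x = 4 \<or> x = 5 \<or> x = 6 \<or> x = 7 \<or> x = 8 \<or> x = 9 \<or>
        x = 10 \<or> x = 11 \<or> x = 12" using that by simp presburger
      then show "rep x \<in> arcs 4 w" by (elim disjE) (simp_all add: rep_def arcs_beta_word)
    qed
    show "fold relabel ?es ?L ! x = fold relabel ?es ?L ! y"
      using assms by (simp add: lab_def label_list_def)
    show "(rep x, rep y) \<in> cn" if "(x, y) \<in> set ?es" for x y using that by (rule conn_rep_edge)
    show "(rep y, rep x) \<in> cn" if "(rep x, rep y) \<in> cn" for x y using that by (rule conn_sym)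
    show "(rep x, rep z) \<in> cn" if "(rep x, rep y) \<in> cn" "(rep y, rep z) \<in> cn" for x y z
      using that by (rule conn_trans)
  qed (use assms in auto)
qed

lemma node_ge_13:
  assumes "a \<in> arcs 4 w" "\<not> node Z a < 13"
  obtains i q where "a = (lv i, q)" "i < k" "q = 2 \<or> q = 3" "0 < cnt Z i" "cnt Z i < card Z"
    "node Z a = 12 + cnt Z i"
proof -
  obtain l q where a: "a = (l, q)" "l < 12 + k" "q < 4" using assms(1) by (auto simp: arcs_beta_word)
  have q: "q = 0 \<or> q = 1 \<or> q = 2 \<or> q = 3" using a(3) by linarith
  have "\<not> l < 12"
  proof
    assume l: "l < 12"
    have "head_node l q < 13"
      using q less_12_cases[OF l] by (elim disjE) (simp_all add: head_node_def)
    with l a assms(2) show False by (simp add: node_def)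
  qed
  then have i: "l = lv (l - 12)" "l - 12 < k" using a lv_less[of "l - 12"] by auto
  have "tail_node Z (l - 12) q \<ge> 13" using assms(2) a \<open>\<not> l < 12\<close> by (simp add: node_def)
  then show ?thesis
    using that[of "l - 12" q] a i q cnt_le_card[of Z "l - 12"] \<open>\<not> l < 12\<close>
    by (auto simp: tail_node_def node_def split: if_splits)
qed

text \<open>In the tail, strands 0 and 1 run down to the closure, arcs above the first 0-resolved
  crossing run up to level 12, and arcs below the last one run down to level 0. From there the
  positive part takes over.\<close>

lemma conn_rep_node:
  assumes "a \<in> arcs 4 w" "node Z a < 13"
  shows "(a, rep (node Z a)) \<in> cn"
proof -
  obtain l q where a: "a = (l, q)" "l < 12 + k" "q < 4" using assms(1) by (auto simp: arcs_beta_word)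
  show ?thesis
  proof (cases "l \<le> 12")
    case True
    then show ?thesis using conn_head_rep a node_le_12 by metis
  next
    case False
    define i where "i = l - 12"
    have i: "l = lv i" "i < k" using a False lv_less[of "l - 12"] by (auto simp: i_def)
    have nd: "node Z a = tail_node Z i q" using a False by (simp add: node_def i_def)
    have r: "((lv 0, q), rep (tail_node Z 0 q)) \<in> cn" "((lv k, q), rep (tail_node Z k q)) \<in> cn"
      using conn_head_rep[of 12 q] conn_head_rep[of 0 q] a(3) lv_less[OF k_pos] lv_k
        head_node_12[of q Z] node_lv[of k q] node_le_12[of 0 q Z] by simp_all
    consider "q < 2" | "cnt Z i = 0" | "cnt Z i = card Z" "2 \<le> q"
      using assms(2) nd cnt_le_card[of Z i] by (auto simp: tail_node_def split: if_splits)
    then show ?thesis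
    proof cases
      case 1
      then have "((lv i, q), (lv k, q)) \<in> cn" using conn_tail_chain[of i k q] i by simp
      moreover have "tail_node Z i q = tail_node Z k q" using 1 by (simp add: tail_node_def)
      ultimately show ?thesis using r(2) nd a(1) i(1) conn_trans by metis
    next
      case 2
      then have "Z \<inter> {0..<i} = {}" using cnt_eq_imp_disjoint[of Z 0 i] by simp
      then have "((lv 0, q), (lv i, q)) \<in> cn" using conn_tail_chain[of 0 i q] i a by simp
      moreover have "tail_node Z i q = tail_node Z 0 q" using 2 by (simp add: tail_node_def)
      ultimately show ?thesis using r(1) nd a(1) i(1) conn_trans conn_sym by metis
    next
      case 3
      then have "Z \<inter> {i..<k} = {}" using cnt_eq_imp_disjoint[of Z i k] cnt_eq_card[OF Z_subset] by simp
      then have "((lv i, q), (lv k, q)) \<in> cn" using conn_tail_chain[of i k q] i a by simp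
      moreover have "tail_node Z i q = tail_node Z k q"
        using 3 cnt_eq_card[OF Z_subset] by (simp add: tail_node_def)
      ultimately show ?thesis using r(2) nd a(1) i(1) conn_trans by metis
    qed
  qed
qed

lemma conn_small:
  assumes "i < k" "j < k" "cnt Z i = cnt Z j" "q = 2 \<or> q = 3" "q' = 2 \<or> q' = 3"
  shows "((lv i, q), (lv j, q')) \<in> cn"
proof -
  have *: "((lv i, q), (lv j, q')) \<in> cn"
    if "i \<le> j" "j < k" "cnt Z i = cnt Z j" "q = 2 \<or> q = 3" "q' = 2 \<or> q' = 3" for i j q q'
  proof -
    have "Z \<inter> {i..<j} = {}" using cnt_eq_imp_disjoint that by simp
    then have "((lv i, q), (lv j, q)) \<in> cn" using conn_tail_chain[of i j q] that by auto
    moreover have "((lv j, q), (lv j, q')) \<in> cn"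
      using conn_tail_cols[of j] that conn_sym conn_refl conn_arcs by (metis less_imp_le_nat)
    ultimately show ?thesis by (rule conn_trans)
  qed
  show ?thesis
  proof (cases "i \<le> j")
    case True
    then show ?thesis using * assms by blast
  next
    case False
    then have "((lv j, q'), (lv i, q)) \<in> cn" using *[of j i q' q] assms by simp
    then show ?thesis by (rule conn_sym)
  qed
qed

text \<open>Big circles are compared through the chosen arcs of their nodes; a small circle is
  determined by the number of 0-resolved crossings above it.\<close>

lemma conn_iff: "(a, b) \<in> cn \<longleftrightarrow> a \<in> arcs 4 w \<and> b \<in> arcs 4 w \<and> lab S (node Z a) = lab S (node Z b)"
proof (rule conn_eqI[of w 4 S "\<lambda>a. lab S (node Z a)"])
  show "lab S (node Z a) = lab S (node Z b)" if "c < length w" "(a, b) \<in> cedges 4 w S c" for a b c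
    using conn_sound that .
  fix a b assume a: "a \<in> arcs 4 w" and b: "b \<in> arcs 4 w" and eq: "lab S (node Z a) = lab S (node Z b)"
  show "(a, b) \<in> cn"
  proof (cases "node Z a < 13")
    case True
    then have b13: "node Z b < 13" using eq lab_less by metis
    have "(rep (node Z a), rep (node Z b)) \<in> cn" using conn_rep True b13 eq by blast
    then show ?thesis
      using conn_rep_node[OF a True] conn_rep_node[OF b b13] conn_sym conn_trans by metis
  next
    case False
    then have b13: "\<not> node Z b < 13" using eq lab_less by metis
    obtain i q where i: "a = (lv i, q)" "i < k" "q = 2 \<or> q = 3" "node Z a = 12 + cnt Z i"
      using node_ge_13[OF a False] by metis
    obtain j q' where j: "b = (lv j, q')" "j < k" "q' = 2 \<or> q' = 3" "node Z b = 12 + cnt Z j"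
      using node_ge_13[OF b b13] by metis
    have "node Z a = node Z b" using eq False b13 by (simp add: lab_def)
    then show ?thesis using i j conn_small by simp
  qed
qed

end

section \<open>The linear system in terms of resolutions\<close>

lemma less_13_cases:
  assumes "x < (13::nat)"
  shows "x = 0 \<or> x = 1 \<or> x = 2 \<or> x = 3 \<or> x = 4 \<or> x = 5 \<or> x = 6 \<or> x = 7 \<or> x = 8 \<or>
    x = 9 \<or> x = 10 \<or> x = 11 \<or> x = 12"
  using assms by presburger

lemma lab_idem: "lab S (lab S x) = lab S x"
proof (cases "x < 13")
  case True
  have *: "\<forall>x\<in>{0,1,2,3,4,5,6,7,8,9,10,11,12}.
      label_list a b c d e ! (label_list a b c d e ! x) = label_list a b c d e ! x" for a b c d e
    by (cases a; cases b; cases c; cases d; cases e; simp add: label_list_table)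
  have "x \<in> {0,1,2,3,4,5,6,7,8,9,10,11,12}" using less_13_cases[OF True] by blast
  from bspec[OF * this] show ?thesis using True lab_less[of S x] by (simp add: lab_def)
qed (simp add: lab_def)

lemma lab_ge: "13 \<le> n \<Longrightarrow> lab S x = n \<longleftrightarrow> x = n"
  using lab_less[of S x] by (cases "x < 13") (auto simp: lab_def)

lemma lab_cong:
  assumes "\<And>c. c \<in> {1, 2, 5, 7, 10} \<Longrightarrow> c \<in> S \<longleftrightarrow> c \<in> S'"
  shows "lab S = lab S'"
  using assms[of 1] assms[of 2] assms[of 5] assms[of 7] assms[of 10]
  by (intro ext) (simp add: lab_def)

definition Phi :: "nat set \<Rightarrow> (nat \<Rightarrow> bool) \<Rightarrow> bool" where
  "Phi S = phi (1 \<in> S) (2 \<in> S) (5 \<in> S) (7 \<in> S) (10 \<in> S)"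

lemma Phi_cong: "(\<And>x. x < 13 \<Longrightarrow> p x = q x) \<Longrightarrow> Phi S p = Phi S q"
  unfolding Phi_def by (rule phi_cong)

lemma Phi_cong_set:
  assumes "\<And>c. c \<in> {1, 2, 5, 7, 10} \<Longrightarrow> c \<in> S \<longleftrightarrow> c \<in> S'"
  shows "Phi S = Phi S'"
  using assms[of 1] assms[of 2] assms[of 5] assms[of 7] assms[of 10] unfolding Phi_def by simp

lemma flip_parity_cong:
  assumes "\<And>x. x < 13 \<Longrightarrow> L x = M x" "\<And>x. x < 13 \<Longrightarrow> L' x = M' x" "\<And>x. x < 13 \<Longrightarrow> p x = q x"
    and f: "\<And>p q. (\<And>x. x < 13 \<Longrightarrow> p x = q x) \<Longrightarrow> f p = f q"
    and "u < 13" "v < 13" "w < 13"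
  shows "flip_parity L L' f u v w p = flip_parity M M' f u v w q"
proof -
  have "f (\<lambda>x. p x \<and> L' x \<noteq> L' u) = f (\<lambda>x. q x \<and> M' x \<noteq> M' u)"
    "f (\<lambda>x. p x \<and> L' x \<noteq> L' w) = f (\<lambda>x. q x \<and> M' x \<noteq> M' w)"
    "f p = f q"
    "f (\<lambda>x. p x \<and> L x \<noteq> L u \<and> L x \<noteq> L v) = f (\<lambda>x. q x \<and> M x \<noteq> M u \<and> M x \<noteq> M v)"
    by (rule f, simp add: assms)+
  moreover have "L u = M u" "L v = M v" "p u = q u" "p v = q v" using assms by auto
  ultimately show ?thesis by (simp only: flip_parity_def)
qed

definition tail_value_at :: "nat set \<Rightarrow> (nat \<Rightarrow> bool) \<Rightarrow> bool" where
  "tail_value_at S p \<longleftrightarrow> (p 9 \<and> Phi S (\<lambda>x. p x \<and> lab S x \<noteq> lab S 9)) \<noteq> (p 4 \<and> Phi S (\<lambda>x. p x \<and> lab S x \<noteq> lab S 4))"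

definition flip_parity_at :: "nat set \<Rightarrow> (nat \<Rightarrow> bool) \<Rightarrow> nat \<Rightarrow> bool" where
  "flip_parity_at S p c = flip_parity (lab S) (lab (insert c S)) (Phi (insert c S))
     (head_node c (c mod 3)) (head_node c (Suc (c mod 3))) (head_node (Suc c) (c mod 3)) p"

text \<open>A labelling \<open>p\<close> that is constant on circles factors through the class
  names, so the finite system applies with \<open>v = p\<close>.\<close>

lemma flip_parity_sum_eq_tail_value:
  assumes p: "\<And>x. x < 13 \<Longrightarrow> p x = p (lab S x)"
  shows "((1 \<notin> S \<and> flip_parity_at S p 1) \<noteq> ((2 \<notin> S \<and> flip_parity_at S p 2) \<noteq> ((5 \<notin> S \<and> flip_parity_at S p 5) \<noteq>
      ((7 \<notin> S \<and> flip_parity_at S p 7) \<noteq> (10 \<notin> S \<and> flip_parity_at S p 10))))) \<longleftrightarrow>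
    (if S \<inter> {1, 2, 5, 7, 10} = {} then Phi S p else tail_value_at S p)"
proof -
  let ?l = "label_list (1 \<in> S) (2 \<in> S) (5 \<in> S) (7 \<in> S) (10 \<in> S)"
  define q where "q = (\<lambda>x. p (?l ! x))"
  have q: "p x = q x" if "x < 13" for x using p[OF that] that by (simp add: q_def lab_def)
  have flip_parity_at: "flip_parity_at S p c = flip_parity ((!) ?l) ((!) (label_list (1 \<in> insert c S) (2 \<in> insert c S) (5 \<in> insert c S) (7 \<in> insert c S) (10 \<in> insert c S)))
      (Phi (insert c S)) (head_node c (c mod 3)) (head_node c (Suc (c mod 3))) (head_node (Suc c) (c mod 3)) q"
    if "c \<in> {1, 2, 5, 7, 10}" for c
    unfolding flip_parity_at_def
  proof (rule flip_parity_cong)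
    show "head_node c (c mod 3) < 13" "head_node c (Suc (c mod 3)) < 13" "head_node (Suc c) (c mod 3) < 13"
      using that by (auto simp: head_node_def)
    show "Phi (insert c S) r = Phi (insert c S) s" if "\<And>x. x < 13 \<Longrightarrow> r x = s x" for r s
      using that by (rule Phi_cong)
  qed (simp_all add: lab_def q)
  have n: "head_node 1 (1 mod 3) = 1" "head_node 1 (Suc (1 mod 3)) = 4" "head_node (Suc 1) (1 mod 3) = 2"
    "head_node 2 (2 mod 3) = 5" "head_node 2 (Suc (2 mod 3)) = 10" "head_node (Suc 2) (2 mod 3) = 6"
    "head_node 5 (5 mod 3) = 6" "head_node 5 (Suc (5 mod 3)) = 11" "head_node (Suc 5) (5 mod 3) = 7"
    "head_node 7 (7 mod 3) = 2" "head_node 7 (Suc (7 mod 3)) = 7" "head_node (Suc 7) (7 mod 3) = 3"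
    "head_node 10 (10 mod 3) = 3" "head_node 10 (Suc (10 mod 3)) = 8" "head_node (Suc 10) (10 mod 3) = 1"
    by (simp_all add: head_node_def)
  have dt: "(if S \<inter> {1, 2, 5, 7, 10} = {} then Phi S p else tail_value_at S p) \<longleftrightarrow>
      tail_value (1 \<in> S) (2 \<in> S) (5 \<in> S) (7 \<in> S) (10 \<in> S) q"
  proof -
    have e: "S \<inter> {1, 2, 5, 7, 10} = {} \<longleftrightarrow> \<not> (1 \<in> S \<or> 2 \<in> S \<or> 5 \<in> S \<or> 7 \<in> S \<or> 10 \<in> S)" by auto
    have *: "Phi S p = Phi S q"
      "Phi S (\<lambda>x. p x \<and> lab S x \<noteq> lab S 9) = Phi S (\<lambda>x. q x \<and> ?l ! x \<noteq> ?l ! 9)"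
      "Phi S (\<lambda>x. p x \<and> lab S x \<noteq> lab S 4) = Phi S (\<lambda>x. q x \<and> ?l ! x \<noteq> ?l ! 4)"
      "p 9 = q 9" "p 4 = q 4"
      by (rule Phi_cong, simp add: q lab_def)+ (simp_all add: q)
    show ?thesis unfolding tail_value_at_def e * unfolding tail_value_def Phi_def ..
  qed
  show ?thesis
    unfolding dt q_def
    unfolding label_list_flip_parity_sum[where v = p, symmetric]
    by (simp only: flip_parity_at[of 1] flip_parity_at[of 2] flip_parity_at[of 5] flip_parity_at[of 7] flip_parity_at[of 10] insertCI n q_def Phi_def insert_iff
      numeral_eq_iff num.simps num.distinct one_eq_numeral_iff numeral_eq_one_iff simp_thms)
qed

text \<open>In a planar diagram a flip either merges two circles or splits one, and never leaves one
  circle as one. For the five crossings this is read off from the table.\<close>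

lemma lab_merge_iff_split:
  assumes "c \<in> {1, 2, 5, 7, 10}" "c \<notin> S"
  shows "lab S (head_node c (c mod 3)) = lab S (head_node c (Suc (c mod 3))) \<longleftrightarrow>
    lab (insert c S) (head_node c (c mod 3)) \<noteq> lab (insert c S) (head_node (Suc c) (c mod 3))"
proof -
  have "label_list False b c d e ! 1 = label_list False b c d e ! 4 \<longleftrightarrow>
      label_list True b c d e ! 1 \<noteq> label_list True b c d e ! 2" for b c d e
    by (cases b; cases c; cases d; cases e; simp add: label_list_table)
  moreover have "label_list a False c d e ! 5 = label_list a False c d e ! 10 \<longleftrightarrow>
      label_list a True c d e ! 5 \<noteq> label_list a True c d e ! 6" for a c d e
    by (cases a; cases c; cases d; cases e; simp add: label_list_table)
  moreover have "label_list a b False d e ! 6 = label_list a b False d e ! 11 \<longleftrightarrow>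
      label_list a b True d e ! 6 \<noteq> label_list a b True d e ! 7" for a b d e
    by (cases a; cases b; cases d; cases e; simp add: label_list_table)
  moreover have "label_list a b c False e ! 2 = label_list a b c False e ! 7 \<longleftrightarrow>
      label_list a b c True e ! 2 \<noteq> label_list a b c True e ! 3" for a b c e
    by (cases a; cases b; cases c; cases e; simp add: label_list_table)
  moreover have "label_list a b c d False ! 3 = label_list a b c d False ! 8 \<longleftrightarrow>
      label_list a b c d True ! 3 \<noteq> label_list a b c d True ! 1" for a b c d
    by (cases a; cases b; cases c; cases d; simp add: label_list_table)
  moreover have "c = 1 \<or> c = 2 \<or> c = 5 \<or> c = 7 \<or> c = 10" using assms(1) by simp
  ultimately show ?thesis using assms(2)
    by (elim disjE) (simp_all add: lab_def head_node_def)
qed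

section \<open>The cocycle\<close>

text \<open>The equality of cardinalities says that the homological degree is 0. The next condition
  is the retraction of the tail: no small circle, tested at its arcs in column 2, is labelled v_+.
  \<open>Phi\<close> reads the labels of all other circles.\<close>

definition cocycle :: "nat \<Rightarrow> nat set \<times> arc set \<Rightarrow> bool" where
  "cocycle k x \<longleftrightarrow> (case x of (S, P) \<Rightarrow>
     S \<inter> {..<12} \<subseteq> {1, 2, 5, 7, 10} \<and> card (S \<inter> {..<12}) = card (zeros k S) \<and>
     (\<forall>i<k. 0 < cnt (zeros k S) i \<and> cnt (zeros k S) i < card (zeros k S) \<longrightarrow> (12 + i, 2) \<notin> P) \<and>
     Phi S (\<lambda>x. rep x \<in> P))"

lemma rep_arcs: "x < 13 \<Longrightarrow> rep x \<in> arcs 4 (beta_word k)"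
  by (drule less_13_cases, elim disjE) (simp_all add: rep_def arcs_beta_word)

lemma node_rep: "x < 13 \<Longrightarrow> node Z (rep x) = x"
  by (drule less_13_cases, elim disjE) (simp_all add: rep_def node_def head_node_def)

context beta_state
begin

lemma rep_mem_cls:
  "x < 13 \<Longrightarrow> a \<in> arcs 4 w \<Longrightarrow> rep x \<in> cls 4 w S a \<longleftrightarrow> lab S x = lab S (node Z a)"
  by (auto simp: conn_iff rep_arcs node_rep)

lemma small_mem_cls:
  assumes "i < k" "0 < cnt Z i" "cnt Z i < card Z" "a \<in> arcs 4 w"
  shows "(12 + i, 2) \<in> cls 4 w S a \<longleftrightarrow> node Z a = 12 + cnt Z i"
proof -
  have n: "node Z (12 + i, 2) = 12 + cnt Z i" using assms by (simp add: node_def tail_node_def)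
  have "(12 + i, 2) \<in> cls 4 w S a \<longleftrightarrow> lab S (node Z a) = lab S (12 + cnt Z i)"
    using assms by (simp add: conn_iff n) (simp add: arcs_beta_word)
  also have "lab S (12 + cnt Z i) = 12 + cnt Z i" using assms by (simp add: lab_def)
  finally show ?thesis using lab_ge[of "12 + cnt Z i" S "node Z a"] assms by simp
qed

lemma gens_mem_iff:
  assumes "(S, P) \<in> gens 4 w" "a \<in> arcs 4 w" "b \<in> arcs 4 w" "lab S (node Z a) = lab S (node Z b)"
  shows "a \<in> P \<longleftrightarrow> b \<in> P"
  using gens_conn[OF assms(1)] assms conn_iff by blast

text \<open>A positive crossing meets no small circle. Their labels do not change, so the condition
  on small circles factors out.\<close>

lemma odd_card_dset_head:
  assumes g: "(S, P) \<in> gens 4 w" and c: "c \<in> {1, 2, 5, 7, 10}" "c \<notin> S"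
    and card: "card Z = Suc (card (S \<inter> {..<12}))"
  shows "odd (card (dset 4 w (cocycle k) S P c)) \<longleftrightarrow>
    (\<forall>i<k. 0 < cnt Z i \<and> cnt Z i < card Z \<longrightarrow> (12 + i, 2) \<notin> P) \<and> flip_parity_at S (\<lambda>x. rep x \<in> P) c"
proof -
  have c12: "c < 12" using c by auto
  let ?S' = "insert c S"
  have Z': "zeros k ?S' = Z" using c12 by (auto simp: zeros_def)
  have hd: "?S' \<inter> {..<12} = insert c (S \<inter> {..<12})" using c12 by auto
  interpret S': beta_state k ?S'
    using S active zeros_ne c c12 by unfold_locales (auto simp: Z')
  have "card (?S' \<inter> {..<12}) = card Z" unfolding hd card using c by simp
  then have co: "cocycle k (?S', Q) \<longleftrightarrow>
      (\<forall>i<k. 0 < cnt Z i \<and> cnt Z i < card Z \<longrightarrow> (12 + i, 2) \<notin> Q) \<and> Phi ?S' (\<lambda>x. rep x \<in> Q)" for Q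
    using S'.active unfolding cocycle_def by (simp add: Z')
  let ?u = "head_node c (c mod 3)" and ?v = "head_node c (Suc (c mod 3))" and ?w = "head_node (Suc c) (c mod 3)"
  have n13: "?u < 13" "?v < 13" "?w < 13" using c by (auto simp: head_node_def)
  have arc: "arcTL w c = (c, c mod 3)" "opp0 w c = (c, Suc (c mod 3))" "opp1 w c = (Suc c, c mod 3)"
    using c12 k_pos by (auto simp: beta_word_nth_head opp0_def opp1_def nlev_beta_word)
  have q4: "c mod 3 < 4" "Suc (c mod 3) < 4" using c by auto
  have arcs: "(c, c mod 3) \<in> arcs 4 w" "(c, Suc (c mod 3)) \<in> arcs 4 w" "(Suc c, c mod 3) \<in> arcs 4 w"
    using c12 k_pos q4 by (auto simp: arcs_beta_word)
  have node: "node Z (c, c mod 3) = ?u" "node Z (c, Suc (c mod 3)) = ?v" "node Z (Suc c, c mod 3) = ?w"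
    using c12 q4 by (simp_all add: node_le_12)
  let ?p = "\<lambda>x. rep x \<in> P"
  have mem: "(c, c mod 3) \<in> P \<longleftrightarrow> ?p ?u" "(c, Suc (c mod 3)) \<in> P \<longleftrightarrow> ?p ?v"
    using gens_mem_iff[OF g] arcs node n13 node_rep rep_arcs by metis+
  have cl: "c < length w" using c12 by (simp add: length_beta_word)
  have small: "(12 + i, 2) \<notin> cls 4 w S (c, c mod 3)" "(12 + i, 2) \<notin> cls 4 w S (c, Suc (c mod 3))"
    "(12 + i, 2) \<notin> cls 4 w ?S' (c, c mod 3)" "(12 + i, 2) \<notin> cls 4 w ?S' (Suc c, c mod 3)"
    if "i < k" "0 < cnt Z i" "cnt Z i < card Z" for i
    using small_mem_cls[OF that] S'.small_mem_cls[unfolded Z', OF that] arcs node n13 that by auto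
  show ?thesis
  proof (cases "lab S ?u = lab S ?v")
    case True
    then have ne: "lab ?S' ?u \<noteq> lab ?S' ?w" using lab_merge_iff_split[OF c] by simp
    have "odd (card (dset 4 w (cocycle k) S P c)) \<longleftrightarrow>
      (if arcTL w c \<in> P
       then cocycle k (?S', P - cls 4 w ?S' (arcTL w c)) \<noteq> cocycle k (?S', P - cls 4 w ?S' (opp1 w c))
       else cocycle k (?S', P))"
      by (rule odd_card_dset_split[OF wf_beta_word cl c(2) g])
        (use True ne in \<open>simp_all add: arc conn_iff S'.conn_iff arcs node Z' beta_word_nth_head[OF c12]\<close>)
    also have "\<dots> \<longleftrightarrow> (\<forall>i<k. 0 < cnt Z i \<and> cnt Z i < card Z \<longrightarrow> (12 + i, 2) \<notin> P) \<and>
      (if ?p ?u then Phi ?S' (\<lambda>x. rep x \<in> P - cls 4 w ?S' (c, c mod 3)) \<noteq>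
          Phi ?S' (\<lambda>x. rep x \<in> P - cls 4 w ?S' (Suc c, c mod 3)) else Phi ?S' ?p)"
      unfolding arc mem co using small by auto
    also have "Phi ?S' (\<lambda>x. rep x \<in> P - cls 4 w ?S' (c, c mod 3)) =
        Phi ?S' (\<lambda>x. ?p x \<and> lab ?S' x \<noteq> lab ?S' ?u)"
      by (rule Phi_cong) (use S'.rep_mem_cls arcs node Z' in auto)
    also have "Phi ?S' (\<lambda>x. rep x \<in> P - cls 4 w ?S' (Suc c, c mod 3)) =
        Phi ?S' (\<lambda>x. ?p x \<and> lab ?S' x \<noteq> lab ?S' ?w)"
      by (rule Phi_cong) (use S'.rep_mem_cls arcs node Z' in auto)
    finally show ?thesis using True by (simp add: flip_parity_at_def flip_parity_def)
  next
    case False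
    then have eq: "lab ?S' ?u = lab ?S' ?w" using lab_merge_iff_split[OF c] by simp
    have "odd (card (dset 4 w (cocycle k) S P c)) \<longleftrightarrow>
      arcTL w c \<in> P \<and> opp0 w c \<in> P \<and> cocycle k (?S', P) \<or>
      (arcTL w c \<in> P) \<noteq> (opp0 w c \<in> P) \<and>
        cocycle k (?S', P - (cls 4 w S (arcTL w c) \<union> cls 4 w S (opp0 w c)))"
      by (rule odd_card_dset_merge[OF wf_beta_word cl c(2) g])
        (use False eq in \<open>simp_all add: arc conn_iff S'.conn_iff arcs node Z' beta_word_nth_head[OF c12]\<close>)
    also have "\<dots> \<longleftrightarrow> (\<forall>i<k. 0 < cnt Z i \<and> cnt Z i < card Z \<longrightarrow> (12 + i, 2) \<notin> P) \<and>
      (?p ?u \<and> ?p ?v \<and> Phi ?S' ?p \<or> ?p ?u \<noteq> ?p ?v \<and>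
        Phi ?S' (\<lambda>x. rep x \<in> P - (cls 4 w S (c, c mod 3) \<union> cls 4 w S (c, Suc (c mod 3)))))"
      unfolding arc mem co using small by auto
    also have "Phi ?S' (\<lambda>x. rep x \<in> P - (cls 4 w S (c, c mod 3) \<union> cls 4 w S (c, Suc (c mod 3)))) =
        Phi ?S' (\<lambda>x. ?p x \<and> lab S x \<noteq> lab S ?u \<and> lab S x \<noteq> lab S ?v)"
      by (rule Phi_cong) (use rep_mem_cls arcs node in auto)
    finally show ?thesis using False by (simp add: flip_parity_at_def flip_parity_def)
  qed
qed

end

section \<open>The negative crossings\<close>

lemma bij_cnt:
  assumes "finite Z"
  shows "bij_betw (cnt Z) Z {..<card Z}"
proof -
  have inj: "inj_on (cnt Z) Z"
  proof (rule linorder_inj_onI)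
    fix x y assume "x < y" "x \<in> Z" "y \<in> Z"
    then have "cnt Z x < cnt Z (Suc x)" "cnt Z (Suc x) \<le> cnt Z y"
      using assms cnt_mono[of Z "Suc x" y] by (auto simp: cnt_Suc)
    then show "cnt Z x \<noteq> cnt Z y" by simp
  qed auto
  moreover have "cnt Z ` Z \<subseteq> {..<card Z}" using cnt_less_card assms by auto
  ultimately have "cnt Z ` Z = {..<card Z}"
    using card_image[OF inj] by (intro card_subset_eq) auto
  with inj show ?thesis by (simp add: bij_betw_def)
qed

lemma cnt_remove:
  assumes "finite Z" "i \<in> Z"
  shows "cnt (Z - {i}) t = (if t \<le> i then cnt Z t else cnt Z t - 1)"
proof (cases "t \<le> i")
  case True
  then have "(Z - {i}) \<inter> {..<t} = Z \<inter> {..<t}" by auto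
  then show ?thesis using True by (simp add: cnt_def)
next
  case False
  then have "(Z - {i}) \<inter> {..<t} = Z \<inter> {..<t} - {i}" by auto
  then show ?thesis using False assms by (simp add: cnt_def)
qed

text \<open>
  \<open>U\<close> is the set of small circles labelled \<open>v\<^sub>+\<close> and \<open>G n\<close> is the contribution of the \<open>n\<close>-th 0-resolved
  negative crossing. If \<open>U = {r}\<close>, merging the circle \<open>r\<close> upwards and downwards gives two equal
  contributions; if \<open>U\<close> has two elements, a \<open>v\<^sub>+\<close> survives on a small circle in every term.
\<close>

lemma tail_parity:
  fixes U :: "nat set" and F :: "bool \<Rightarrow> bool \<Rightarrow> bool"
  assumes U: "U \<subseteq> {0<..<j}" and j: "2 \<le> j"
    and a: "\<And>y. \<not> a \<Longrightarrow> F True y = F False y" and b: "\<And>x. \<not> b \<Longrightarrow> F x True = F x False"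
    and G: "\<And>n. n < j \<Longrightarrow> G n \<longleftrightarrow>
      (let T = (if n = 0 then a else n \<in> U); B = (if Suc n = j then b else Suc n \<in> U) in
        T \<and> B \<and> (\<forall>r\<in>U. r = n \<and> Suc n = j \<or> r = Suc n \<and> n = 0) \<and> F False False \<or>
        T \<noteq> B \<and> U \<subseteq> {n, Suc n} \<and> F (n = 0) (Suc n = j))"
  shows "odd (card {n. n < j \<and> G n}) \<longleftrightarrow> U = {} \<and> (a \<and> F True False) \<noteq> (b \<and> F False True)"
proof -
  consider "U = {}" | r where "U = {r}" | r s where "r \<in> U" "s \<in> U" "r \<noteq> s"
    by (metis is_singletonI' is_singleton_the_elem)
  then show ?thesis
  proof cases
    case 1
    \<comment> \<open>Without small v_+ circles only the first and the last crossing can contribute,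
      through the top and the bottom arc of \<open>e\<close>; they differ since
      \<open>2 \<le> j\<close>.\<close>
    have "{n. n < j \<and> G n} = (if a \<and> F True False then {0} else {}) \<union> (if b \<and> F False True then {j - 1} else {})"
      using j by (auto simp: G 1 Let_def split: if_splits)
    then show ?thesis using 1 j by auto
  next
    case (2 r)
    have r: "0 < r" "r < j" using U 2 by auto
    have "{n. n < j \<and> G n} = (if F False False then {r - 1, r} else {})"
    proof (intro set_eqI)
      fix n
      have "n < j \<and> G n \<longleftrightarrow> (n = r - 1 \<or> n = r) \<and> F False False"
      proof (cases "n = r - 1 \<or> n = r")
        case True
        then have "n < j" using r by auto
        \<comment> \<open>Both crossings next to the circle \<open>r\<close> give the same value.
          This includes \<open>r = 1\<close> and \<open>r = j - 1\<close>, where the neighbour is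
          the top or bottom arc: if that arc is labelled v_-, setting it to v_- is invisible to
          \<open>F\<close> by \<open>a\<close> and \<open>b\<close>.\<close>
        moreover have "G n \<longleftrightarrow> F False False"
          using True r j a[of False] a[of True] b[of False] b[of True]
          by (cases a; cases b) (auto simp: G[OF \<open>n < j\<close>] 2 Let_def)
        ultimately show ?thesis using True by simp
      next
        case False
        then have "\<not> G n" if "n < j" using r by (auto simp: G[OF that] 2 Let_def)
        with False show ?thesis by auto
      qed
      then show "n \<in> {n. n < j \<and> G n} \<longleftrightarrow> n \<in> (if F False False then {r - 1, r} else {})" by auto
    qed
    then show ?thesis using 2 r by auto
  next
    case (3 r s)
    have "\<not> G n" if n: "n < j" for n
    proof
      assume "G n"
      then have "(\<forall>r\<in>U. r = n \<and> Suc n = j \<or> r = Suc n \<and> n = 0) \<or>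
        (if n = 0 then a else n \<in> U) \<noteq> (if Suc n = j then b else Suc n \<in> U) \<and> U \<subseteq> {n, Suc n}"
        unfolding G[OF n] Let_def by (elim disjE conjE) simp_all
      then show False
      proof (elim disjE conjE)
        assume all: "\<forall>r\<in>U. r = n \<and> Suc n = j \<or> r = Suc n \<and> n = 0"
        from bspec[OF all 3(1)] bspec[OF all 3(2)] show False using 3(3) j by auto
      next
        assume ne: "(if n = 0 then a else n \<in> U) \<noteq> (if Suc n = j then b else Suc n \<in> U)"
          and "U \<subseteq> {n, Suc n}"
        then have "n \<in> U" "Suc n \<in> U" using 3 by auto
        then show False using ne U by auto
      qed
    qed
    then have none: "{n. n < j \<and> G n} = {}" by auto
    have "U \<noteq> {}" using 3(1) by auto
    then show ?thesis unfolding none by simp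
  qed
qed

context beta_state
begin

definition plus_small :: "arc set \<Rightarrow> nat set" where
  "plus_small P = {r. 0 < r \<and> r < card Z \<and> (\<exists>i<k. cnt Z i = r \<and> (12 + i, 2) \<in> P)}"

lemma tail_mem:
  assumes g: "(S, P) \<in> gens 4 w" and t: "t \<le> k"
  shows "(lv t, 2) \<in> P \<longleftrightarrow>
    (if cnt Z t = 0 then rep 9 \<in> P else if cnt Z t = card Z then rep 4 \<in> P else cnt Z t \<in> plus_small P)"
proof -
  have arc: "(lv t, 2) \<in> arcs 4 w" by (simp add: lv_def arcs_beta_word)
  have nd: "node Z (lv t, 2) = tail_node Z t 2" using node_lv[OF t] by simp
  consider "cnt Z t = 0" | "cnt Z t = card Z" "cnt Z t \<noteq> 0" | "0 < cnt Z t" "cnt Z t < card Z"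
    using cnt_le_card[of Z t] by fastforce
  then show ?thesis
  proof cases
    case 1
    then show ?thesis
      using gens_mem_iff[OF g arc rep_arcs[of 9]] nd by (simp add: node_rep tail_node_def)
  next
    case 2
    then show ?thesis
      using gens_mem_iff[OF g arc rep_arcs[of 4]] nd by (simp add: node_rep tail_node_def)
  next
    case 3
    have "t \<noteq> k" using 3 cnt_eq_card[OF Z_subset] by auto
    then have tk: "t < k" using t by simp
    have "(12 + i, 2) \<in> P \<longleftrightarrow> (lv t, 2) \<in> P" if "i < k" "cnt Z i = cnt Z t" for i
      using gens_conn[OF g conn_small[of i t 2 2]] that tk by (simp add: lv_less)
    then have "cnt Z t \<in> plus_small P \<longleftrightarrow> (lv t, 2) \<in> P"
      using 3 tk unfolding plus_small_def by auto
    then show ?thesis using 3 by simp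
  qed
qed

lemma clean_iff:
  "(\<forall>i<k. 0 < cnt Z i \<and> cnt Z i < card Z \<longrightarrow> (12 + i, 2) \<notin> P) \<longleftrightarrow> plus_small P = {}"
  unfolding plus_small_def by auto

lemma p_lab:
  assumes "(S, P) \<in> gens 4 w" "x < 13"
  shows "rep x \<in> P \<longleftrightarrow> rep (lab S x) \<in> P"
  using gens_mem_iff[OF assms(1) rep_arcs rep_arcs, of x "lab S x"] assms(2)
  by (simp add: node_rep lab_less lab_idem)

text \<open>Flipping crossing number \<open>n\<close> merges the circles above and below it. The
  result is small unless \<open>n = 0\<close> or \<open>Suc n = card Z\<close>; then it absorbs a
  small circle into the top or bottom arc of \<open>e\<close>, where a v_+ is judged by
  \<open>Phi\<close> and no longer excluded.\<close>

lemma odd_card_dset_tail: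
  assumes g: "(S, P) \<in> gens 4 w" and i: "i \<in> Z" and j: "2 \<le> card Z"
    and card: "card Z = Suc (card (S \<inter> {..<12}))"
  defines "n \<equiv> cnt Z i" and "U \<equiv> plus_small P"
  shows "odd (card (dset 4 w (cocycle k) S P (12 + i))) \<longleftrightarrow>
    (let T = (if n = 0 then rep 9 \<in> P else n \<in> U); B = (if Suc n = card Z then rep 4 \<in> P else Suc n \<in> U) in
      T \<and> B \<and> (\<forall>r\<in>U. r = n \<and> Suc n = card Z \<or> r = Suc n \<and> n = 0) \<and>
        Phi S (\<lambda>x. rep x \<in> P \<and> \<not> (False \<and> lab S x = lab S 9) \<and> \<not> (False \<and> lab S x = lab S 4)) \<or>
      T \<noteq> B \<and> U \<subseteq> {n, Suc n} \<and>
        Phi S (\<lambda>x. rep x \<in> P \<and> \<not> (n = 0 \<and> lab S x = lab S 9) \<and> \<not> (Suc n = card Z \<and> lab S x = lab S 4)))"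
proof -
  have ik: "i < k" using i Z_subset by auto
  have nlt: "n < card Z" using cnt_less_card i by (simp add: n_def)
  have nS: "cnt Z (Suc i) = Suc n" using i by (simp add: cnt_Suc n_def)
  let ?c = "12 + i" and ?S' = "insert (12 + i) S"
  have cS: "?c \<notin> S" using i by (simp add: zeros_def)
  have Z': "zeros k ?S' = Z - {i}" by (auto simp: zeros_def)
  have hd: "?S' \<inter> {..<12} = S \<inter> {..<12}" by auto
  have cZ': "card (Z - {i}) = card Z - 1" using i by simp
  have Z'ne: "Z - {i} \<noteq> {}"
  proof
    assume "Z - {i} = {}"
    then have "card (Z - {i}) = 0" by (simp only: card.empty)
    with cZ' j show False by simp
  qed
  interpret S': beta_state k ?S'
    using S active ik Z'ne by unfold_locales (auto simp: Z' hd)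
  have labS': "lab ?S' = lab S" by (rule lab_cong) auto
  have PhiS': "Phi ?S' = Phi S" by (rule Phi_cong_set) auto
  have cl: "?c < length w" using ik by (simp add: length_beta_word)
  have "Suc ?c mod nlev w = lv (Suc i)" using Suc_mod[of i] by simp
  then have arc: "arcTL w ?c = (lv i, 2)" "opp0 w ?c = (lv (Suc i), 2)" "opp1 w ?c = (lv i, 3)"
    using ik by (simp_all add: beta_word_nth_tail opp0_def opp1_def lv_less)
  have arcs: "(lv i, 2) \<in> arcs 4 w" "(lv (Suc i), 2) \<in> arcs 4 w" "(lv i, 3) \<in> arcs 4 w"
    by (simp_all add: lv_def arcs_beta_word)
  have node: "node Z (lv i, 2) = (if n = 0 then 9 else 12 + n)"
    "node Z (lv (Suc i), 2) = (if Suc n = card Z then 4 else 13 + n)"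
    using ik nlt nS by (simp_all add: node_lv tail_node_def n_def)
  \<comment> \<open>As \<open>card Z\<close> is at least 2, one of the two circles is small, so they
    are different and the flip is a merge.\<close>
  have old: "((lv i, 2), (lv (Suc i), 2)) \<notin> cn"
    using nlt j lab_less[of S 9] lab_less[of S 4] by (auto simp: conn_iff node lab_def)
  have new: "((lv i, 2), (lv i, 3)) \<in> conn 4 w ?S'"
    using S'.conn_tail_cols[of i] ik by (simp add: S'.lv_def lv_def)
  \<comment> \<open>After the flip the lower small circles are renumbered; in the old numbering the
    two exceptions are the circles that cease to be small.\<close>
  have co: "cocycle k (?S', Q) \<longleftrightarrow>
      (\<forall>t<k. 0 < cnt Z t \<and> cnt Z t < card Z \<and> (12 + t, 2) \<in> Q \<longrightarrow>
        cnt Z t = n \<and> Suc n = card Z \<or> cnt Z t = Suc n \<and> n = 0) \<and> Phi S (\<lambda>x. rep x \<in> Q)" for Q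
  proof -
    have le: "t \<le> i \<Longrightarrow> cnt Z t \<le> n" "i < t \<Longrightarrow> Suc n \<le> cnt Z t" for t
      using cnt_mono[of Z t i] cnt_mono[of Z "Suc i" t] nS by (auto simp: n_def)
    have "(0 < cnt (Z - {i}) t \<and> cnt (Z - {i}) t < card Z - 1) \<longleftrightarrow>
        0 < cnt Z t \<and> cnt Z t < card Z \<and> \<not> (cnt Z t = n \<and> Suc n = card Z \<or> cnt Z t = Suc n \<and> n = 0)" for t
      using le[of t] nlt j by (cases "t \<le> i") (auto simp: cnt_remove[OF finite_zeros i])
    then have "(\<forall>t<k. 0 < cnt (Z - {i}) t \<and> cnt (Z - {i}) t < card Z - 1 \<longrightarrow> (12 + t, 2) \<notin> Q) \<longleftrightarrow>
      (\<forall>t<k. 0 < cnt Z t \<and> cnt Z t < card Z \<and> (12 + t, 2) \<in> Q \<longrightarrow>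
        cnt Z t = n \<and> Suc n = card Z \<or> cnt Z t = Suc n \<and> n = 0)" by metis
    then show ?thesis
      unfolding cocycle_def prod.case Z' hd cZ' PhiS' using active card by simp
  qed
  let ?X = "cls 4 w S (lv i, 2) \<union> cls 4 w S (lv (Suc i), 2)"
  have coP: "cocycle k (?S', P) \<longleftrightarrow>
      (\<forall>r\<in>U. r = n \<and> Suc n = card Z \<or> r = Suc n \<and> n = 0) \<and> Phi S (\<lambda>x. rep x \<in> P)"
    unfolding co U_def plus_small_def by blast
  have coX: "cocycle k (?S', P - ?X) \<longleftrightarrow> U \<subseteq> {n, Suc n} \<and>
      Phi S (\<lambda>x. rep x \<in> P \<and> \<not> (n = 0 \<and> lab S x = lab S 9) \<and> \<not> (Suc n = card Z \<and> lab S x = lab S 4))"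
  proof -
    have sm: "(12 + t, 2) \<in> P - ?X \<longleftrightarrow> (12 + t, 2) \<in> P \<and> cnt Z t \<noteq> n \<and> cnt Z t \<noteq> Suc n"
      if "t < k" "0 < cnt Z t" "cnt Z t < card Z" for t
      using small_mem_cls[OF that arcs(1)] small_mem_cls[OF that arcs(2)] that
      by (auto simp: node split: if_splits)
    have "(\<forall>t<k. 0 < cnt Z t \<and> cnt Z t < card Z \<and> (12 + t, 2) \<in> P - ?X \<longrightarrow>
        cnt Z t = n \<and> Suc n = card Z \<or> cnt Z t = Suc n \<and> n = 0) \<longleftrightarrow> U \<subseteq> {n, Suc n}"
      unfolding U_def plus_small_def using sm by blast
    moreover have "Phi S (\<lambda>x. rep x \<in> P - ?X) =
      Phi S (\<lambda>x. rep x \<in> P \<and> \<not> (n = 0 \<and> lab S x = lab S 9) \<and> \<not> (Suc n = card Z \<and> lab S x = lab S 4))"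
    proof (rule Phi_cong)
      fix x :: nat assume x: "x < 13"
      then have l: "lab S x < 13" by (simp add: lab_less)
      have "rep x \<in> cls 4 w S (lv i, 2) \<longleftrightarrow> n = 0 \<and> lab S x = lab S 9"
        using rep_mem_cls[OF x arcs(1)] l by (auto simp: node lab_def[of S "12 + n"] split: if_splits)
      moreover have "rep x \<in> cls 4 w S (lv (Suc i), 2) \<longleftrightarrow> Suc n = card Z \<and> lab S x = lab S 4"
        using rep_mem_cls[OF x arcs(2)] l by (auto simp: node lab_def[of S "13 + n"] split: if_splits)
      ultimately show "rep x \<in> P - ?X \<longleftrightarrow> rep x \<in> P \<and> \<not> (n = 0 \<and> lab S x = lab S 9) \<and>
          \<not> (Suc n = card Z \<and> lab S x = lab S 4)" by blast
    qed
    ultimately show ?thesis unfolding co by simp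
  qed
  have T: "(lv i, 2) \<in> P \<longleftrightarrow> (if n = 0 then rep 9 \<in> P else n \<in> U)"
    using tail_mem[OF g, of i] ik nlt by (simp add: n_def U_def)
  have B: "(lv (Suc i), 2) \<in> P \<longleftrightarrow> (if Suc n = card Z then rep 4 \<in> P else Suc n \<in> U)"
    using tail_mem[OF g, of "Suc i"] ik by (simp add: nS U_def)
  have "odd (card (dset 4 w (cocycle k) S P ?c)) \<longleftrightarrow>
    arcTL w ?c \<in> P \<and> opp0 w ?c \<in> P \<and> cocycle k (?S', P) \<or>
    (arcTL w ?c \<in> P) \<noteq> (opp0 w ?c \<in> P) \<and>
      cocycle k (?S', P - (cls 4 w S (arcTL w ?c) \<union> cls 4 w S (opp0 w ?c)))"
    by (rule odd_card_dset_merge[OF wf_beta_word cl cS g]) (simp_all only: arc old new not_False_eq_True)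
  then show ?thesis unfolding arc coP coX T B Let_def by simp
qed

lemma odd_sum_dset_tail:
  assumes g: "(S, P) \<in> gens 4 w" and j: "2 \<le> card Z"
    and card: "card Z = Suc (card (S \<inter> {..<12}))"
  shows "odd (\<Sum>i\<in>Z. card (dset 4 w (cocycle k) S P (12 + i))) \<longleftrightarrow>
    plus_small P = {} \<and> tail_value_at S (\<lambda>x. rep x \<in> P)"
proof -
  define F where "F = (\<lambda>a b. Phi S (\<lambda>x. rep x \<in> P \<and> \<not> (a \<and> lab S x = lab S 9) \<and> \<not> (b \<and> lab S x = lab S 4)))"
  define G where "G = (\<lambda>n. let T = (if n = 0 then rep 9 \<in> P else n \<in> plus_small P);
      B = (if Suc n = card Z then rep 4 \<in> P else Suc n \<in> plus_small P) in
        T \<and> B \<and> (\<forall>r\<in>plus_small P. r = n \<and> Suc n = card Z \<or> r = Suc n \<and> n = 0) \<and> F False False \<or>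
        T \<noteq> B \<and> plus_small P \<subseteq> {n, Suc n} \<and> F (n = 0) (Suc n = card Z))"
  have o: "odd (card (dset 4 w (cocycle k) S P (12 + i))) \<longleftrightarrow> G (cnt Z i)" if "i \<in> Z" for i
    using odd_card_dset_tail[OF g that j card] unfolding G_def F_def .
  have "{i \<in> Z. odd (card (dset 4 w (cocycle k) S P (12 + i)))} = {i \<in> Z. G (cnt Z i)}" using o by auto
  then have "odd (\<Sum>i\<in>Z. card (dset 4 w (cocycle k) S P (12 + i))) \<longleftrightarrow> odd (card {i \<in> Z. G (cnt Z i)})"
    by (simp add: even_sum_iff)
  also have "card {i \<in> Z. G (cnt Z i)} = card (cnt Z ` {i \<in> Z. G (cnt Z i)})"
    using bij_cnt[of Z] by (intro card_image[symmetric]) (auto simp: bij_betw_def inj_on_def)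
  also have "cnt Z ` {i \<in> Z. G (cnt Z i)} = {n. n < card Z \<and> G n}"
    using bij_cnt[of Z] by (auto simp: bij_betw_def)
  also have "odd (card {n. n < card Z \<and> G n}) \<longleftrightarrow>
      plus_small P = {} \<and> (rep 9 \<in> P \<and> F True False) \<noteq> (rep 4 \<in> P \<and> F False True)"
  proof (rule tail_parity[OF _ j])
    show "plus_small P \<subseteq> {0<..<card Z}" by (auto simp: plus_small_def)
    \<comment> \<open>If the circle through node 9 or 4 is labelled v_- already, making it v_-
      changes nothing.\<close>
    have nm: "rep x \<notin> P" if "rep y \<notin> P" "lab S x = lab S y" "x < 13" "y < 13" for x y
      using p_lab[OF g] that by metis
    show "F True y = F False y" if "rep 9 \<notin> P" for y
      unfolding F_def using nm[OF that] by (intro Phi_cong) auto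
    show "F x True = F x False" if "rep 4 \<notin> P" for x
      unfolding F_def using nm[OF that] by (intro Phi_cong) auto
  qed (simp add: G_def)
  also have "\<dots> \<longleftrightarrow> plus_small P = {} \<and> tail_value_at S (\<lambda>x. rep x \<in> P)"
    by (simp add: tail_value_at_def F_def)
  finally show ?thesis .
qed

end

text \<open>The circles of the oriented resolution are the four strands. It has no 0-resolved
  negative crossing, so the description by nodes does not cover it.\<close>

lemma conn_vertical_iff:
  assumes "\<And>c. c < 12 + k \<Longrightarrow> vert (beta_word k) S c"
  shows "(a, b) \<in> conn 4 (beta_word k) S \<longleftrightarrow>
    a \<in> arcs 4 (beta_word k) \<and> b \<in> arcs 4 (beta_word k) \<and> snd a = snd b"
proof (rule conn_eqI)
  let ?w = "beta_word k"
  show "snd a = snd b" if "c < length ?w" "(a, b) \<in> cedges 4 ?w S c" for c a b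
    using that assms by (auto simp: cedges_def Let_def length_beta_word)
  have top: "((0, q), (l, q)) \<in> conn 4 ?w S" if "l < 12 + k" "q < 4" for l q
    using that
  proof (induction l)
    case 0
    then show ?case by (simp add: conn_refl arcs_beta_word)
  next
    case (Suc l)
    have "((l, q), (Suc l, q)) \<in> conn 4 ?w S"
      by (rule conn_cedge[OF wf_beta_word, of l])
        (use Suc assms in \<open>auto simp: length_beta_word cedges_def Let_def nlev_beta_word\<close>)
    then show ?case using Suc conn_trans by (metis Suc_lessD)
  qed
  fix a b assume "a \<in> arcs 4 ?w" "b \<in> arcs 4 ?w" "snd a = snd b"
  then show "(a, b) \<in> conn 4 ?w S"
    using top[of "fst a" "snd a"] top[of "fst b" "snd b"] conn_sym conn_trans
    by (metis arcs_beta_word atLeastLessThan_iff mem_Times_iff prod.collapse)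
qed

context beta_state
begin

text \<open>The saddle from \<open>e\<close> to 1 splits the circle through strands 2 and 3. A v_+
  on it leaves a v_+ on one of the two strands in either target, while v_- gives v_- v_-. So
  \<open>Phi\<close> is the same before and after.\<close>

lemma odd_card_dset_single:
  assumes g: "(S, P) \<in> gens 4 w" and Z: "Z = {i}" and hd: "S \<inter> {..<12} = {}"
  shows "odd (card (dset 4 w (cocycle k) S P (12 + i))) \<longleftrightarrow> Phi S (\<lambda>x. rep x \<in> P)"
proof -
  have i: "i \<in> Z" and ik: "i < k" using Z Z_subset by auto
  let ?c = "12 + i" and ?S' = "insert (12 + i) S"
  have cS: "?c \<notin> S" using i by (simp add: zeros_def)
  have Z': "zeros k ?S' = {}" using Z by (auto simp: zeros_def)
  have hd': "?S' \<inter> {..<12} = {}" using hd by auto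
  have cl: "?c < length w" using ik by (simp add: length_beta_word)
  have vert: "vert w ?S' c" if "c < 12 + k" for c
  proof (cases "c < 12")
    case True
    then show ?thesis using hd by (auto simp: vert_def beta_word_nth_head)
  next
    case False
    then have "c - 12 \<notin> zeros k ?S'" using Z' by simp
    then have "c \<in> ?S'" using False that by (auto simp: zeros_def)
    then show ?thesis using False that by (simp add: vert_def beta_word_nth_tail')
  qed
  note conn' = conn_vertical_iff[OF vert]
  have nS: "1 \<notin> S" "2 \<notin> S" "5 \<notin> S" "7 \<notin> S" "10 \<notin> S" using hd by auto
  \<comment> \<open>With none of the five crossings 1-resolved, \<open>phi\<close> accepts only the
    labelling by v_- throughout.\<close>
  have phi: "Phi S p \<longleftrightarrow> (\<forall>x<13. \<not> p x)" for p
  proof -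
    have "x < 13 \<longleftrightarrow> x \<in> {0,1,2,3,4,5,6,7,8,9,10,11,12}" for x :: nat
      using less_13_cases[of x] by auto
    then have "(\<forall>x<13. \<not> p x) \<longleftrightarrow> (\<forall>x\<in>{0,1,2,3,4,5,6,7,8,9,10,11,12}. \<not> p x)" by blast
    then show ?thesis using nS by (simp add: Phi_def phi_def)
  qed
  have phiD: "\<not> Phi S p" if "p x" "x < 13" for p x using phi that by blast
  have PhiS': "Phi ?S' = Phi S" by (rule Phi_cong_set) auto
  have co: "cocycle k (?S', Q) \<longleftrightarrow> Phi S (\<lambda>x. rep x \<in> Q)" for Q
    unfolding cocycle_def prod.case Z' hd' PhiS' by simp
  have "Suc ?c mod nlev w = lv (Suc i)" using Suc_mod[of i] by simp
  then have arc: "arcTL w ?c = (lv i, 2)" "opp0 w ?c = (lv (Suc i), 2)" "opp1 w ?c = (lv i, 3)"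
    using ik by (simp_all add: beta_word_nth_tail opp0_def opp1_def lv_less)
  have arcs: "(lv i, 2) \<in> arcs 4 w" "(lv (Suc i), 2) \<in> arcs 4 w" "(lv i, 3) \<in> arcs 4 w"
    by (simp_all add: lv_def arcs_beta_word)
  have lab: "lab S 9 = 4" "lab S 4 = 4" "lab S 10 = 4" using nS by (simp_all add: lab_def label_list_table)
  have cnt: "cnt Z i = 0" "cnt Z (Suc i) = 1" unfolding Z by (simp_all add: cnt_def)
  have node: "node Z (lv i, 2) = 9" "node Z (lv (Suc i), 2) = 4"
    using ik cnt by (simp_all add: node_lv tail_node_def) (simp add: Z)
  have old: "((lv i, 2), (lv (Suc i), 2)) \<in> cn" using arcs by (simp add: conn_iff node lab)
  have new: "((lv i, 2), (lv i, 3)) \<notin> conn 4 w ?S'" by (simp add: conn')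
  have mem: "rep 4 \<in> P" "rep 10 \<in> P" if "(lv i, 2) \<in> P"
    using that gens_mem_iff[OF g arcs(1) rep_arcs[of 4]] gens_mem_iff[OF g arcs(1) rep_arcs[of 10]]
    by (simp_all add: node node_rep lab)
  have "odd (card (dset 4 w (cocycle k) S P ?c)) \<longleftrightarrow>
    (if arcTL w ?c \<in> P
     then cocycle k (?S', P - cls 4 w ?S' (arcTL w ?c)) \<noteq> cocycle k (?S', P - cls 4 w ?S' (opp1 w ?c))
     else cocycle k (?S', P))"
    by (rule odd_card_dset_split[OF wf_beta_word cl cS g]) (simp_all only: arc old new not_False_eq_True)
  also have "\<dots> \<longleftrightarrow> Phi S (\<lambda>x. rep x \<in> P)"
  proof (cases "(lv i, 2) \<in> P")
    case True
    \<comment> \<open>The chosen arcs of nodes 4 and 10 lie on strands 2 and 3.\<close>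
    have "rep 10 \<in> P - cls 4 w ?S' (lv i, 2)" "rep 4 \<in> P - cls 4 w ?S' (lv i, 3)"
      using mem[OF True] by (simp_all add: conn' rep_def)
    then have "\<not> Phi S (\<lambda>x. rep x \<in> P - cls 4 w ?S' (lv i, 2))"
      "\<not> Phi S (\<lambda>x. rep x \<in> P - cls 4 w ?S' (lv i, 3))"
      using phiD[of "\<lambda>x. rep x \<in> P - cls 4 w ?S' (lv i, 2)" 10]
        phiD[of "\<lambda>x. rep x \<in> P - cls 4 w ?S' (lv i, 3)" 4] by simp_all
    moreover have "\<not> Phi S (\<lambda>x. rep x \<in> P)" using mem(1)[OF True] phiD[of "\<lambda>x. rep x \<in> P" 4] by simp
    ultimately show ?thesis unfolding arc co using True by simp
  next
    case False
    then show ?thesis unfolding arc co by simp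
  qed
  finally show ?thesis .
qed

text \<open>The positive and the negative crossings contribute the same value, so the total vanishes
  mod 2.\<close>

lemma even_sum_dset:
  assumes g: "(S, P) \<in> gens 4 w" and card: "card Z = Suc (card (S \<inter> {..<12}))"
  shows "even (\<Sum>c\<in>{0..<length w} - S. card (dset 4 w (cocycle k) S P c))"
proof -
  let ?d = "\<lambda>c. card (dset 4 w (cocycle k) S P c)"
  let ?p = "\<lambda>x. rep x \<in> P"
  let ?K = "{1, 2, 5, 7, 10} :: nat set"
  have un: "{0..<length w} - S = ({..<12} - S) \<union> (+) 12 ` Z"
  proof (intro set_eqI)
    fix c
    show "c \<in> {0..<length w} - S \<longleftrightarrow> c \<in> ({..<12} - S) \<union> (+) 12 ` Z"
    proof (cases "c < 12")
      case True
      then show ?thesis by (auto simp: length_beta_word)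
    next
      case False
      then obtain i where "c = 12 + i" using le_Suc_ex not_less by blast
      then show ?thesis by (auto simp: length_beta_word zeros_def)
    qed
  qed
  have "sum ?d ({0..<length w} - S) = sum ?d ({..<12} - S) + sum ?d ((+) 12 ` Z)"
    unfolding un by (rule sum.union_disjoint) auto
  also have "sum ?d ((+) 12 ` Z) = (\<Sum>i\<in>Z. ?d (12 + i))"
    by (subst sum.reindex) (auto simp: inj_on_def)
  also have "sum ?d ({..<12} - S) = (\<Sum>c\<in>?K. if c \<in> S then 0 else ?d c)"
  proof -
    \<comment> \<open>1-resolving any other positive crossing leaves the support of the
      cocycle.\<close>
    have z: "?d c = 0" if "c \<in> {..<12} - S" "c \<notin> ?K" for c
      using that by (auto simp: dset_def cocycle_def)
    have "sum ?d ({..<12} - S) = sum ?d (?K - S)"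
    proof (rule sum.mono_neutral_right)
      show "\<forall>c\<in>({..<12} - S) - (?K - S). ?d c = 0" using z by blast
    qed auto
    also have "\<dots> = (\<Sum>c\<in>?K - S. if c \<in> S then 0 else ?d c)" by (intro sum.cong) auto
    also have "\<dots> = (\<Sum>c\<in>?K. if c \<in> S then 0 else ?d c)"
      by (rule sum.mono_neutral_left) auto
    finally show ?thesis .
  qed
  finally have split: "sum ?d ({0..<length w} - S) = (\<Sum>c\<in>?K. if c \<in> S then 0 else ?d c) + (\<Sum>i\<in>Z. ?d (12 + i))" .
  have h: "odd (if c \<in> S then 0 else ?d c) \<longleftrightarrow> plus_small P = {} \<and> c \<notin> S \<and> flip_parity_at S ?p c" if "c \<in> ?K" for c
    using odd_card_dset_head[OF g that _ card] clean_iff by auto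
  have "odd (\<Sum>c\<in>?K. if c \<in> S then 0 else ?d c) \<longleftrightarrow> plus_small P = {} \<and>
     ((1 \<notin> S \<and> flip_parity_at S ?p 1) \<noteq> ((2 \<notin> S \<and> flip_parity_at S ?p 2) \<noteq> ((5 \<notin> S \<and> flip_parity_at S ?p 5) \<noteq>
      ((7 \<notin> S \<and> flip_parity_at S ?p 7) \<noteq> (10 \<notin> S \<and> flip_parity_at S ?p 10)))))"
  proof -
    define f where "f c = (if c \<in> S then 0 else ?d c)" for c
    have s: "(\<Sum>c\<in>?K. if c \<in> S then 0 else ?d c) = f 1 + (f 2 + (f 5 + (f 7 + f 10)))"
      by (simp add: f_def[symmetric])
    have o: "odd (a + (b + (c + (d + e)))) \<longleftrightarrow>
        (odd a \<noteq> (odd b \<noteq> (odd c \<noteq> (odd d \<noteq> odd e))))" for a b c d e :: nat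
      by (cases "even a"; cases "even b"; cases "even c"; cases "even d"; simp)
    have f: "odd (f 1) \<longleftrightarrow> plus_small P = {} \<and> 1 \<notin> S \<and> flip_parity_at S ?p 1"
      "odd (f 2) \<longleftrightarrow> plus_small P = {} \<and> 2 \<notin> S \<and> flip_parity_at S ?p 2"
      "odd (f 5) \<longleftrightarrow> plus_small P = {} \<and> 5 \<notin> S \<and> flip_parity_at S ?p 5"
      "odd (f 7) \<longleftrightarrow> plus_small P = {} \<and> 7 \<notin> S \<and> flip_parity_at S ?p 7"
      "odd (f 10) \<longleftrightarrow> plus_small P = {} \<and> 10 \<notin> S \<and> flip_parity_at S ?p 10"
      unfolding f_def by (rule h; simp)+
    show ?thesis unfolding s o f by (cases "plus_small P = {}") simp_all
  qed
  also have "\<dots> \<longleftrightarrow> plus_small P = {} \<and> (if S \<inter> ?K = {} then Phi S ?p else tail_value_at S ?p)"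
    using flip_parity_sum_eq_tail_value[of ?p S] p_lab[OF g] by simp
  finally have hd: "odd (\<Sum>c\<in>?K. if c \<in> S then 0 else ?d c) \<longleftrightarrow>
    plus_small P = {} \<and> (if S \<inter> ?K = {} then Phi S ?p else tail_value_at S ?p)" .
  have SK: "S \<inter> {..<12} = S \<inter> ?K" using active by auto
  have fin: "finite (S \<inter> ?K)" by simp
  have tl: "odd (\<Sum>i\<in>Z. ?d (12 + i)) \<longleftrightarrow>
    plus_small P = {} \<and> (if S \<inter> ?K = {} then Phi S ?p else tail_value_at S ?p)"
  proof (cases "S \<inter> ?K = {}")
    case True
    then have "card Z = 1" using card SK by simp
    then obtain i where Z: "Z = {i}" by (rule card_1_singletonE)
    have "plus_small P = {}" using \<open>card Z = 1\<close> by (auto simp: plus_small_def)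
    then show ?thesis using odd_card_dset_single[OF g Z] True SK by (simp add: Z)
  next
    case False
    then have "0 < card (S \<inter> ?K)" using fin card_gt_0_iff by blast
    then have "2 \<le> card Z" using card SK by simp
    then show ?thesis unfolding if_not_P[OF False] by (rule odd_sum_dset_tail[OF g _ card])
  qed
  show ?thesis unfolding split even_add using hd tl by blast
qed

end

lemma even_card_cocycle:
  assumes z: "z \<in> gens 4 (beta_word k)"
  shows "even (card {y. cocycle k y \<and> dcoef 4 (beta_word k) z y})"
proof -
  obtain S P where SP: "z = (S, P)" by fastforce
  have g: "(S, P) \<in> gens 4 (beta_word k)" using z SP by simp
  have S: "S \<subseteq> {0..<12 + k}" using g by (auto simp: gens_def length_beta_word)
  show ?thesis
  proof (cases "S \<inter> {..<12} \<subseteq> {1, 2, 5, 7, 10} \<and> card (zeros k S) = Suc (card (S \<inter> {..<12}))")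
    case True
    then interpret beta_state k S using S by unfold_locales auto
    show ?thesis unfolding SP card_dcoef_eq_sum_dset[OF g] using even_sum_dset[OF g] True by simp
  next
    case False
    \<comment> \<open>Every flip lowers by one the number of 0-resolved negative crossings minus
      that of 1-resolved positive ones, and 1-resolved crossings stay 1-resolved. So no successor of
      a state of another kind lies in the support.\<close>
    have "\<not> cocycle k (insert c S, P')" if c: "c < 12 + k" "c \<notin> S" for c P'
    proof (cases "c < 12")
      case True
      have "zeros k (insert c S) = zeros k S" using True by (auto simp: zeros_def)
      moreover have "insert c S \<inter> {..<12} = insert c (S \<inter> {..<12})" using True by auto
      ultimately show ?thesis using False c by (auto simp: cocycle_def)
    next
      case c12: False
      then have i: "c - 12 \<in> zeros k S" using c by (auto simp: zeros_def)
      have "zeros k (insert c S) = zeros k S - {c - 12}" using c12 by (auto simp: zeros_def)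
      moreover have "insert c S \<inter> {..<12} = S \<inter> {..<12}" using c12 by auto
      moreover have "card (zeros k S) = Suc (card (zeros k S - {c - 12}))"
        using card.remove[OF _ i] by simp
      ultimately show ?thesis using False by (auto simp: cocycle_def)
    qed
    then have "{y. cocycle k y \<and> dcoef 4 (beta_word k) z y} = {}"
      unfolding SP by (auto elim!: dcoef_cases simp: length_beta_word)
    then show ?thesis by (simp only: card.empty even_zero)
  qed
qed

theorem theorem5p1:
  fixes k :: nat and m :: arc
  assumes "m \<in> arcs 4 (beta_word k)"
  shows "psi'_nonzero 4 (beta_word k) m"
proof (rule psi'_nonzeroI[OF wf_beta_word assms refl, where \<phi> = "cocycle k"])
  let ?w = "beta_word k"
  let ?S0 = "{c \<in> {0..<length ?w}. \<not> snd (?w ! c)}"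
  have S0: "c \<in> ?S0 \<longleftrightarrow> 12 \<le> c \<and> c < 12 + k" for c
    by (cases "c < 12") (auto simp: length_beta_word beta_word_nth_head beta_word_nth_tail')
  have vert: "vert ?w ?S0 c" if "c < 12 + k" for c
    using that by (simp add: vert_def length_beta_word)
  show "\<not> dcoef 4 ?w (?S0, {}) y" for y
  proof
    assume d: "dcoef 4 ?w (?S0, {}) y"
    obtain c P' where c: "c < length ?w" "c \<notin> ?S0" "y = (insert c ?S0, P')"
      using d by (rule dcoef_cases)
    \<comment> \<open>All crossings are vertical, so a flip merges two different strands, both
      labelled v_-, and v_- v_- gives zero.\<close>
    have ne: "(arcTL ?w c, arcTR ?w c) \<notin> conn 4 ?w ?S0" 
      using conn_vertical_iff[of k ?S0, OF vert, of "arcTL ?w c" "arcTR ?w c"] by simp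
    have t: "arcTL ?w c \<in> touched ?w c" "arcTR ?w c \<in> touched ?w c" by (simp_all add: touched_eq)
    have "cls 4 ?w ?S0 (arcTL ?w c) \<noteq> cls 4 ?w ?S0 (arcTR ?w c)"
      using ne cls_eq_iff t touched_subset_arcs[OF wf_beta_word c(1)] by blast
    moreover have "vert ?w ?S0 c" using vert c by (simp add: length_beta_word)
    ultimately have "card (cls 4 ?w ?S0 ` touched ?w c) = 2"
      using cls_touched_vert[OF wf_beta_word c(1)] by simp
    then obtain t where "t \<in> touched ?w c" "cls 4 ?w ?S0 t \<subseteq> {}"
      using d unfolding c(3) dcoef_insert_iff[OF wf_beta_word c(1,2)] Let_def by auto
    then show False
      using mem_cls_self touched_subset_arcs[OF wf_beta_word c(1)] by blast
  qed
  have "?S0 = {12..<12 + k}" unfolding set_eq_iff S0 by simp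
  moreover have "zeros k {12..<12 + k} = {}" "{12..<12 + k} \<inter> {..<12} = {}"
    by (auto simp: zeros_def)
  ultimately show "cocycle k (?S0, {})"
    by (simp only: cocycle_def prod.case) (simp add: Phi_def phi_def)
qed (rule even_card_cocycle)

end
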